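(* Let $p\in(0,1)$. Let $s=s(p)$ be the unique solution in $(0,1)$ to $s\log\left(\frac{(1-p)(2-s)}{1-s}\right)=1$, and let $p_0\approx 0.206$ be the unique solution in $(0,1/2)$ to $\log\left(\frac{1-p}{p}\right)=\frac{1-p}{1-2p}$. Define $c_L,c_U:(0,1)\to\mathbb{R}$ by $c_L(p)=\exp(1/s)\,s(2-s)p$ and $$c_U(p)=\begin{cases} c_L(p) & \text{if } p_0\le p<1,\\ \left(\log\left(\frac{1-p}{p}\right)\right)^{-1} & \text{if } 0<p<p_0.\end{cases}$$ Then for every fixed $\varepsilon>0$, a.a.s. as $n\to\infty$ the height of the random-surfer tree model with $n$ vertices and parameter $p$ is between $(c_L(p)-\varepsilon)\log n$ and $(c_U(p)+\varepsilon)\log n$.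
   Context: $\mathrm{Geo}(p)$ denotes a geometric random variable with $\Pr[\mathrm{Geo}(p)=k]=(1-p)^kp$ for integers $k\ge 0$. The random-surfer Webgraph model with $d=1$ and parameter $p$: start with a root $v_0$ having one self-loop; at each step $s$, $1\le s\le n-1$, a new vertex $v_s$ appears, chooses $u$ uniformly at random from $\{v_0,\dots,v_{s-1}\}$ and a fresh $X=\mathrm{Geo}(p)$, performs a simple random walk of length $X$ from $u$ along out-edges, and creates an edge from $v_s$ to the last vertex of the walk. The random-surfer tree model is the undirected tree obtained from this graph by deleting the self-loop of the root and ignoring edge directions. The height of a rooted tree is the maximum graph distance between a vertex and the root. A.a.s. means with probability tending to $1$ as $n\to\infty$; $\log$ is natural. *)

theory Defs
  imports "HOL-Analysis.Analysis" "HOL-Probability.Probability"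
begin

text \<open>A random-surfer tree with d = 1 on vertices 0..m-1 is encoded by its parent list
  t of length m: t ! v is the out-neighbour of v (the unique out-edge of v),
  with t ! 0 = 0 (the self-loop at the root).\<close>

definition rs_step :: "real \<Rightarrow> nat list \<Rightarrow> nat list pmf" where
  "rs_step p t =
     do { u \<leftarrow> pmf_of_set {..<length t};
          X \<leftarrow> geometric_pmf p;
          return_pmf (t @ [((\<lambda>v. t ! v) ^^ X) u]) }"

primrec rs_graph :: "real \<Rightarrow> nat \<Rightarrow> nat list pmf" where
  "rs_graph p 0 = return_pmf [0]"
| "rs_graph p (Suc k) = rs_graph p k \<bind> rs_step p"

definition rs_tree :: "real \<Rightarrow> nat \<Rightarrow> nat list pmf" where
  "rs_tree p n = rs_graph p (n - 1)"

text \<open>Graph distance of vertex v to the root 0 in the tree (parents have smaller index).\<close>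
definition depth :: "nat list \<Rightarrow> nat \<Rightarrow> nat" where
  "depth t v = (LEAST k. ((\<lambda>w. t ! w) ^^ k) v = 0)"

definition height :: "nat list \<Rightarrow> nat" where
  "height t = Max (depth t ` {..<length t})"

definition s_param :: "real \<Rightarrow> real" where
  "s_param p = (THE s. 0 < s \<and> s < 1 \<and> s * ln ((1 - p) * (2 - s) / (1 - s)) = 1)"

definition p0 :: real where
  "p0 = (THE q. 0 < q \<and> q < 1/2 \<and> ln ((1 - q) / q) = (1 - q) / (1 - 2 * q))"

definition c_L :: "real \<Rightarrow> real" where
  "c_L p = exp (1 / s_param p) * s_param p * (2 - s_param p) * p"

definition c_U :: "real \<Rightarrow> real" where
  "c_U p = (if p0 \<le> p then c_L p else 1 / ln ((1 - p) / p))"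

end

theory Submission
  imports Defs "HOL-Real_Asymp.Real_Asymp"
begin

text \<open>The new vertex has depth \<open>max (D - X) 0 + 1\<close>, where \<open>D\<close> is the depth of a uniform vertex and
  \<open>X\<close> is geometric. Write \<open>\<phi>(\<alpha>) = E exp (\<alpha> * (1 - X))\<close>.

  Upper bound: \<open>a k\<close>, the expectation of the sum of \<open>exp (\<alpha> * depth)\<close> over the first \<open>k\<close> vertices,
  satisfies \<open>a (k + 1) \<le> (1 + \<phi>(\<alpha>) / k) * a k + exp \<alpha>\<close>. So it grows at most like \<open>k powr \<psi>\<close> for every
  \<open>\<psi> > max 1 \<phi>(\<alpha>)\<close>, and Markov's inequality bounds the height by \<open>\<psi> / \<alpha> * ln n\<close>. The
  minimum of \<open>\<phi>(\<alpha>) / \<alpha>\<close> is \<open>c_L p\<close>, attained at \<open>\<alpha> = 1 / s\<close>; for \<open>p < p0\<close> one has \<open>\<phi>(1 / s) < 1\<close>, and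
  the best choice is the root \<open>\<alpha> = ln ((1 - p) / p)\<close> of \<open>\<phi>(\<alpha>) = 1\<close>.

  Lower bound: if \<open>f k \<le> f (k + 1) + (1 - \<delta>) / k * E f (k + 1) (max (\<cdot> - X) 0 + 1)\<close> and
  \<open>0 \<le> f \<le> \<delta>\<close>, then the expectation of the product of \<open>exp (- f k (depth v))\<close> over all vertices does
  not increase with \<open>k\<close>. A travelling wave \<open>f k d = g (d - c * ln (k / n\<^sub>0) + x\<^sub>1)\<close> with \<open>g = 0\<close> on the
  negative axis and \<open>g = \<delta>\<close> beyond \<open>x\<^sub>1\<close> is such a family for every \<open>c < c_L p\<close>. Since all depths
  are nonnegative, every one of the first \<open>n\<^sub>0\<close> vertices contributes \<open>\<delta>\<close> at time \<open>n\<^sub>0\<close>, so the height is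
  below \<open>c * ln (n / n\<^sub>0) - x\<^sub>1\<close> with probability at most \<open>exp (- n\<^sub>0 * \<delta>)\<close>, where \<open>n\<^sub>0\<close> is arbitrary.\<close>

subsection \<open>Depths and one step of the process\<close>

text \<open>The invariant of all lists in the support of \<open>rs_graph\<close>. Since parents have
  smaller index, facts about walks follow by induction on the vertex.\<close>

definition rec_tree :: "nat list \<Rightarrow> bool" where
  "rec_tree t \<longleftrightarrow> t \<noteq> [] \<and> t ! 0 = 0 \<and> (\<forall>v<length t. 0 < v \<longrightarrow> t ! v < v)"

lemma rec_tree_nth_le: "rec_tree t \<Longrightarrow> v < length t \<Longrightarrow> t ! v \<le> v"
  by (cases "v = 0") (auto simp: rec_tree_def dest: less_imp_le)

lemma rec_tree_funpow_le: "rec_tree t \<Longrightarrow> v < length t \<Longrightarrow> ((!) t ^^ k) v \<le> v"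
proof (induction k)
  case (Suc k)
  then have "((!) t ^^ k) v \<le> v" by simp
  moreover have "t ! (((!) t ^^ k) v) \<le> ((!) t ^^ k) v"
    using Suc.prems calculation by (intro rec_tree_nth_le) auto
  ultimately show ?case by simp
qed simp

lemma rec_tree_snoc: "rec_tree t \<Longrightarrow> w < length t \<Longrightarrow> rec_tree (t @ [w])"
  by (auto simp: rec_tree_def nth_append less_Suc_eq)

lemma depth_0 [simp]: "depth t 0 = 0"
  by (simp add: depth_def)

lemma rec_tree_reaches_root:
  assumes "rec_tree t" "v < length t"
  shows "\<exists>k. ((!) t ^^ k) v = 0"
  using assms(2)
proof (induction v rule: less_induct)
  case (less v)
  show ?case
  proof (cases "v = 0")
    case True
    then show ?thesis by (intro exI[of _ 0]) simp
  next
    case False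
    with assms less.prems have "t ! v < v" by (simp add: rec_tree_def)
    with less obtain k where "((!) t ^^ k) (t ! v) = 0" by (meson less_trans)
    then show ?thesis by (intro exI[of _ "Suc k"]) (simp add: funpow_swap1)
  qed
qed

lemma depth_nonroot:
  assumes "rec_tree t" "v < length t" "0 < v"
  shows "depth t v = Suc (depth t (t ! v))"
proof -
  obtain k where "((!) t ^^ k) v = 0"
    using rec_tree_reaches_root[OF assms(1,2)] by blast
  from Least_Suc[of "\<lambda>k. ((!) t ^^ k) v = 0", OF this] assms(3)
  have "depth t v = Suc (LEAST m. ((!) t ^^ Suc m) v = 0)"
    by (simp add: depth_def)
  then show ?thesis by (simp only: depth_def funpow_Suc_right o_apply)
qed

lemma depth_parent:
  assumes "rec_tree t" "v < length t"
  shows "depth t (t ! v) = depth t v - 1"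
  using depth_nonroot[OF assms] assms by (cases "v = 0") (auto simp: rec_tree_def)

text \<open>Truncated subtraction absorbs the self-loop: a walk that has reached the root stays
  there, at depth \<open>0\<close>.\<close>

lemma depth_funpow:
  assumes "rec_tree t" "v < length t"
  shows "depth t (((!) t ^^ k) v) = depth t v - k"
proof (induction k)
  case (Suc k)
  have "((!) t ^^ k) v < length t"
    using rec_tree_funpow_le[OF assms, of k] assms(2) by linarith
  from depth_parent[OF assms(1) this] Suc show ?case by simp
qed simp

text \<open>Parents of old vertices are old, so walks from them never see the new entry.\<close>

lemma depth_append:
  assumes "rec_tree t" "w < length t" "v < length t"
  shows "depth (t @ [w]) v = depth t v"
  using assms(3)
proof (induction v rule: less_induct)
  case (less v)
  show ?case
  proof (cases "v = 0")
    case False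
    with assms less.prems have lt: "t ! v < v" by (simp add: rec_tree_def)
    have "depth (t @ [w]) v = Suc (depth (t @ [w]) (t ! v))"
      using depth_nonroot[OF rec_tree_snoc[OF assms(1,2)], of v] False less.prems
      by (simp add: nth_append)
    also have "\<dots> = Suc (depth t (t ! v))" using less lt by simp
    also have "\<dots> = depth t v" using depth_nonroot[OF assms(1) less.prems] False by simp
    finally show ?thesis .
  qed simp
qed

lemma depth_new:
  assumes "rec_tree t" "w < length t"
  shows "depth (t @ [w]) (length t) = Suc (depth t w)"
  using depth_nonroot[OF rec_tree_snoc[OF assms], of "length t"] assms
  by (simp add: nth_append depth_append rec_tree_def)

section \<open>Sums over the depth profile\<close>

definition depth_sum :: "(nat \<Rightarrow> real) \<Rightarrow> nat list \<Rightarrow> real" where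
  "depth_sum f t = (\<Sum>v<length t. f (depth t v))"

text \<open>Reduces the tree to its depth profile: a step adds one summand, which depends only on
  the depth of \<open>u\<close> and the walk length.\<close>

lemma depth_sum_attach:
  assumes "rec_tree t" "u < length t"
  shows "depth_sum f (t @ [((!) t ^^ k) u]) = depth_sum f t + f (Suc (depth t u - k))"
proof -
  have "((!) t ^^ k) u < length t"
    using rec_tree_funpow_le[OF assms, of k] assms(2) by linarith
  then show ?thesis using assms(1)
    by (simp add: depth_sum_def depth_append depth_new depth_funpow[OF assms])
qed

lemma depth_sum_nonneg: "(\<And>d. 0 \<le> f d) \<Longrightarrow> 0 \<le> depth_sum f t"
  by (simp add: depth_sum_def sum_nonneg)

lemma height_le_iff:
  "rec_tree t \<Longrightarrow> height t \<le> h \<longleftrightarrow> (\<forall>v<length t. depth t v \<le> h)"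
  unfolding height_def by (subst Max_le_iff) (auto simp: rec_tree_def)

lemma height_attained: "rec_tree t \<Longrightarrow> \<exists>v<length t. depth t v = height t"
proof -
  assume "rec_tree t"
  then have "Max (depth t ` {..<length t}) \<in> depth t ` {..<length t}"
    by (intro Max_in) (auto simp: rec_tree_def)
  then show ?thesis unfolding height_def by force
qed

lemma set_pmf_rs_graph:
  assumes "t \<in> set_pmf (rs_graph p k)"
  shows "rec_tree t \<and> length t = Suc k"
  using assms
proof (induction k arbitrary: t)
  case 0
  then show ?case by (simp add: rec_tree_def)
next
  case (Suc k)
  then obtain t' u X where t': "t' \<in> set_pmf (rs_graph p k)"
    and u: "u \<in> set_pmf (pmf_of_set {..<length t'})" and t: "t = t' @ [((!) t' ^^ X) u]"
    by (auto simp: rs_step_def)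
  from Suc.IH[OF t'] have "rec_tree t'" "length t' = Suc k" by auto
  moreover from this u have "u < length t'" by (simp add: set_pmf_of_set lessThan_empty_iff)
  moreover from this have "((!) t' ^^ X) u < length t'"
    using rec_tree_funpow_le[of t' u X] \<open>rec_tree t'\<close> by linarith
  ultimately show ?case using t rec_tree_snoc by simp
qed

text \<open>Nonnegative integrals over trees pass through the bind without integrability conditions;
  the inner expectation is a real integral, so that it can be handled by series and
  linearity.\<close>

lemma nn_integral_rs_step:
  assumes "t \<noteq> []" "\<And>t. 0 \<le> F t"
    and "\<And>u. u < length t \<Longrightarrow> integrable (geometric_pmf p) (\<lambda>X. F (t @ [((!) t ^^ X) u]))"
  shows "(\<integral>\<^sup>+t'. ennreal (F t') \<partial>rs_step p t) =
    ennreal ((\<Sum>u<length t. measure_pmf.expectation (geometric_pmf p)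
      (\<lambda>X. F (t @ [((!) t ^^ X) u]))) / length t)"
proof -
  have "(\<integral>\<^sup>+t'. ennreal (F t') \<partial>rs_step p t) =
    (\<Sum>u<length t. \<integral>\<^sup>+X. ennreal (F (t @ [((!) t ^^ X) u])) \<partial>geometric_pmf p) / length t"
    unfolding rs_step_def nn_integral_bind_pmf nn_integral_return_pmf
    using assms(1) by (subst nn_integral_pmf_of_set) (auto simp: ennreal_of_nat_eq_real_of_nat)
  also have "\<dots> = (\<Sum>u<length t. ennreal (measure_pmf.expectation (geometric_pmf p)
      (\<lambda>X. F (t @ [((!) t ^^ X) u])))) / length t"
    by (intro arg_cong2[where f = "(/)"] sum.cong nn_integral_eq_integral refl assms(3))
       (auto simp: assms(2))
  also have "\<dots> = ennreal (\<Sum>u<length t. measure_pmf.expectation (geometric_pmf p)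
      (\<lambda>X. F (t @ [((!) t ^^ X) u]))) / ennreal (length t)"
    by (simp add: sum_ennreal assms(2) ennreal_of_nat_eq_real_of_nat)
  also have "\<dots> = ennreal ((\<Sum>u<length t. measure_pmf.expectation (geometric_pmf p)
      (\<lambda>X. F (t @ [((!) t ^^ X) u]))) / length t)"
    using assms(1) by (intro divide_ennreal sum_nonneg) (auto simp: assms(2))
  finally show ?thesis .
qed

section \<open>Integration against the geometric law\<close>

lemma integrable_geometric_bounded:
  fixes f :: "nat \<Rightarrow> real"
  assumes "\<And>k. \<bar>f k\<bar> \<le> B"
  shows "integrable (geometric_pmf p) f"
  by (rule measure_pmf.integrable_const_bound[where B = B]) (use assms in auto)

lemma
  fixes f :: "nat \<Rightarrow> real"
  assumes p: "0 < p" "p < 1" and s: "summable (\<lambda>k. (1 - p) ^ k * p * \<bar>f k\<bar>)"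
  shows integrable_geometric: "integrable (geometric_pmf p) f"
    and expectation_geometric_sums:
      "(\<lambda>k. (1 - p) ^ k * p * f k) sums measure_pmf.expectation (geometric_pmf p) f"
proof -
  have eq: "pmf (geometric_pmf p) k *\<^sub>R f k = (1 - p) ^ k * p * f k" for k
    using p by simp
  have abs: "summable (\<lambda>k. norm ((1 - p) ^ k * p * f k))"
    using s p by (simp add: abs_mult)
  have int: "integrable (count_space UNIV) (\<lambda>k. pmf (geometric_pmf p) k *\<^sub>R f k)"
    unfolding eq using abs by (simp add: integrable_count_space_nat_iff)
  then show i: "integrable (geometric_pmf p) f"
    unfolding measure_pmf_eq_density by (subst integrable_density) auto
  have "measure_pmf.expectation (geometric_pmf p) f =
      (\<integral>k. (1 - p) ^ k * p * f k \<partial>count_space UNIV)"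
    unfolding measure_pmf_eq_density by (subst integral_density) (auto simp: eq[unfolded real_scaleR_def] simp del: pmf_geometric)
  then show "(\<lambda>k. (1 - p) ^ k * p * f k) sums measure_pmf.expectation (geometric_pmf p) f"
    using sums_integral_count_space_nat[OF int] unfolding eq by simp
qed

subsection \<open>Exponential tilting and the travelling profile\<close>

text \<open>The tilted weights are \<open>p * exp \<alpha> * r ^ k\<close>, so the geometric series
  and its derivative give \<phi>(\<alpha>) and \<phi>'(\<alpha>); the third fact is the finiteness
  of \<phi>''(\<alpha>).\<close>

lemma
  fixes p \<alpha> :: real
  assumes p: "0 < p" "p < 1" and \<alpha>: "0 < \<alpha>"
  defines "r \<equiv> (1 - p) * exp (- \<alpha>)"
  shows tilt_sums_0: "(\<lambda>k. (1 - p) ^ k * p * exp (\<alpha> * (1 - real k))) sums (p * exp \<alpha> / (1 - r))"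
    and tilt_sums_1: "(\<lambda>k. (1 - p) ^ k * p * exp (\<alpha> * (1 - real k)) * (1 - real k)) sums
      (p * exp \<alpha> * (1 - 2 * r) / (1 - r)\<^sup>2)"
    and tilt_summable_2:
      "summable (\<lambda>k. (1 - p) ^ k * p * exp (\<alpha> * (1 - real k)) * (1 - real k)\<^sup>2)"
proof -
  have r: "0 < r" "r < 1"
  proof -
    show "0 < r" using p by (simp add: r_def)
    have "(1 - p) * exp (- \<alpha>) < 1 * 1" using p \<alpha> by (intro mult_strict_mono) auto
    then show "r < 1" by (simp add: r_def)
  qed
  have w: "(1 - p) ^ k * p * exp (\<alpha> * (1 - real k)) = p * exp \<alpha> * r ^ k" for k
    unfolding r_def power_mult_distrib
    by (simp add: exp_of_nat_mult[symmetric] exp_add[symmetric] algebra_simps exp_diff exp_minus field_simps)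
  have s0: "(\<lambda>k. r ^ k) sums (1 / (1 - r))" using r by (intro geometric_sums) auto
  have s1: "(\<lambda>k. real (Suc k) * r ^ k) sums (1 / (1 - r)\<^sup>2)"
    using r geometric_deriv_sums[of r] by simp
  show "(\<lambda>k. (1 - p) ^ k * p * exp (\<alpha> * (1 - real k))) sums (p * exp \<alpha> / (1 - r))"
    unfolding w using sums_mult[OF s0, of "p * exp \<alpha>"] by simp
  \<comment> \<open>Uses \<open>1 - k = 2 - (k + 1)\<close> to match the differentiated
    series.\<close>
  have "(\<lambda>k. p * exp \<alpha> * (2 * r ^ k - real (Suc k) * r ^ k)) sums
      (p * exp \<alpha> * (2 * (1 / (1 - r)) - 1 / (1 - r)\<^sup>2))"
    by (intro sums_mult sums_diff s0 s1)
  moreover have "p * exp \<alpha> * (2 * (1 / (1 - r)) - 1 / (1 - r)\<^sup>2) =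
      p * exp \<alpha> * (1 - 2 * r) / (1 - r)\<^sup>2"
  proof -
    have "2 * (1 / d) - 1 / d\<^sup>2 = (2 * d - 1) / d\<^sup>2" if "d \<noteq> 0" for d :: real
      using that by (simp add: field_simps power2_eq_square)
    from this[of "1 - r"] show ?thesis using r by simp
  qed
  ultimately show "(\<lambda>k. (1 - p) ^ k * p * exp (\<alpha> * (1 - real k)) * (1 - real k)) sums
      (p * exp \<alpha> * (1 - 2 * r) / (1 - r)\<^sup>2)"
    unfolding w by (simp add: algebra_simps)
  have bigo: "(\<lambda>k. (1 - real k)\<^sup>2 * r ^ k) \<in> O(\<lambda>k. ((1 + r) / 2) ^ k)"
    using r by real_asymp
  have "summable (\<lambda>k. norm (((1 + r) / 2) ^ k))"
    using r by (simp add: summable_geometric_iff norm_power)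
  from summable_comparison_test_bigo[OF this bigo]
  have "summable (\<lambda>k. (1 - real k)\<^sup>2 * r ^ k)" .
  from summable_mult[OF this, of "p * exp \<alpha>"]
  show "summable (\<lambda>k. (1 - p) ^ k * p * exp (\<alpha> * (1 - real k)) * (1 - real k)\<^sup>2)"
    unfolding w by (simp add: algebra_simps)
qed

text \<open>The profile is \<open>exp (\<alpha> * x) * (\<beta> * x) * (1 - \<beta> * x)\<close> for small \<open>\<beta>\<close>, set to \<open>0\<close> for negative \<open>x\<close>
  and frozen at its maximum; the parabola replaces the sine that occurs in the exact complex
  eigenfunctions of the linearised travelling wave equation for speeds below \<open>C\<close>.\<close>

lemma travelling_profile:
  fixes p \<alpha> c C :: real
  assumes p: "0 < p" "p < 1" and \<alpha>: "0 < \<alpha>" and c: "0 < c" "c < C"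
    and s0: "(\<lambda>k. (1 - p) ^ k * p * exp (\<alpha> * (1 - real k))) sums (C * \<alpha>)"
    and s1: "(\<lambda>k. (1 - p) ^ k * p * exp (\<alpha> * (1 - real k)) * (1 - real k)) sums C"
    and s2: "summable (\<lambda>k. (1 - p) ^ k * p * exp (\<alpha> * (1 - real k)) * (1 - real k)\<^sup>2)"
  obtains M e\<^sub>0 :: real and g :: "real \<Rightarrow> real" and x\<^sub>1 :: real
  where "0 < M" "0 < e\<^sub>0" "mono g" "\<And>x. x \<le> 0 \<Longrightarrow> g x = 0" "\<And>x. x\<^sub>1 \<le> x \<Longrightarrow> g x = M"
    "\<And>x. 0 \<le> g x" "\<And>x. g x \<le> M"
    "\<And>x e. 0 \<le> e \<Longrightarrow> e \<le> e\<^sub>0 \<Longrightarrow>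
      c * (g (x + e) - g x) \<le> e * measure_pmf.expectation (geometric_pmf p) (\<lambda>X. g (x + 1 - real X))"
proof -
  define w where "w k = (1 - p) ^ k * p * exp (\<alpha> * (1 - real k))" for k
  define \<kappa> where "\<kappa> = (\<Sum>k. w k * (1 - real k)\<^sup>2)"
  have \<kappa>: "0 \<le> \<kappa>" unfolding \<kappa>_def
    using s2 p by (intro suminf_nonneg) (auto simp: w_def)
  \<comment> \<open>The gap below \<open>C\<close> pays for the second-order Taylor term, the gap
    above \<open>c\<close> for replacing a derivative by a finite step \<open>e\<close>.\<close>
  define c\<^sub>1 where "c\<^sub>1 = (c + C) / 2"
  have c\<^sub>1: "c < c\<^sub>1" "c\<^sub>1 < C" "0 < c\<^sub>1" using c by (auto simp: c\<^sub>1_def)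
  \<comment> \<open>Chosen so that \<open>q \<ge> R * \<beta>\<^sup>2\<close> makes the Taylor error
    \<open>\<beta>\<^sup>2 * \<kappa>\<close> at most \<open>(C - c\<^sub>1) * q\<close>.\<close>
  define R where "R = \<kappa> / (C - c\<^sub>1) + 1"
  have R: "1 \<le> R" using \<kappa> c\<^sub>1 by (simp add: R_def)
  \<comment> \<open>The first two bounds make \<open>q\<close> at least
    \<open>R * \<beta>\<^sup>2\<close> on \<open>[0, 3/4]\<close>; the third lets the single jump
    \<open>k = 0\<close> suffice above \<open>3/4\<close> whenever \<open>q\<close> is smaller than
    that.\<close>
  define \<beta> where "\<beta> = min (3 * \<alpha> / 16) (min (1 / (4 * R)) (p / (2 * \<alpha> * c\<^sub>1 * R)))"
  have \<beta>: "0 < \<beta>" using \<alpha> R p c\<^sub>1 by (simp add: \<beta>_def)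
  have \<beta>1: "\<beta> \<le> 3 * \<alpha> / 16" and "\<beta> \<le> 1 / (4 * R)" and "\<beta> \<le> p / (2 * \<alpha> * c\<^sub>1 * R)"
    by (auto simp: \<beta>_def)
  then have \<beta>2: "R * \<beta> \<le> 1 / 4" and \<beta>3: "2 * \<alpha> * c\<^sub>1 * R * \<beta> \<le> p"
    using R \<alpha> c\<^sub>1 by (simp_all add: field_simps)
  define h where "h y = y * (1 - y)" for y :: real
  \<comment> \<open>\<open>exp (\<alpha> * x) * q (\<beta> * x)\<close> is the derivative of the
    profile. By \<open>s0\<close> and \<open>s1\<close>, \<open>C\<close> times it is also the
    expected profile after a jump, up to second order: here \<phi> = C * \<alpha> and \<phi>' = C
    are used together.\<close>
  define q where "q y = \<alpha> * h y + \<beta> * (1 - 2 * y)" for y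
  obtain y\<^sub>1 where y\<^sub>1: "0 \<le> y\<^sub>1" "y\<^sub>1 \<le> 1" "q y\<^sub>1 = 0"
    using IVT2'[of q 1 0 0] \<beta> by (force simp: q_def h_def intro!: continuous_intros)
  with \<beta> have y\<^sub>1': "0 < y\<^sub>1" "y\<^sub>1 < 1"
    by (auto simp: q_def h_def less_le)
  \<comment> \<open>The second factor is positive for \<open>y \<ge> 0\<close>, so \<open>q\<close>
    changes sign there only at \<open>y\<^sub>1\<close>, where the profile peaks.\<close>
  have q_factor: "y\<^sub>1 * q y = (y\<^sub>1 - y) * (\<alpha> * y * y\<^sub>1 + \<beta>)" for y
    using y\<^sub>1(3) unfolding q_def h_def by algebra
  have q_pos: "0 \<le> q y" if "0 \<le> y" "y \<le> y\<^sub>1" for y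
  proof -
    have "0 \<le> y\<^sub>1 * q y" unfolding q_factor using that \<alpha> \<beta> by (intro mult_nonneg_nonneg) auto
    then show ?thesis using y\<^sub>1' by (simp add: zero_le_mult_iff)
  qed
  have q_neg: "q y \<le> 0" if "y\<^sub>1 \<le> y" for y
  proof -
    have "y\<^sub>1 * q y \<le> 0" unfolding q_factor
      using that \<alpha> \<beta> y\<^sub>1' by (intro mult_nonpos_nonneg) auto
    then show ?thesis using y\<^sub>1' by (simp add: mult_le_0_iff)
  qed
  define x\<^sub>1 where "x\<^sub>1 = y\<^sub>1 / \<beta>"
  have x\<^sub>1: "0 < x\<^sub>1" "\<beta> * x\<^sub>1 = y\<^sub>1" using \<beta> y\<^sub>1' by (auto simp: x\<^sub>1_def)
  define G where "G x = exp (\<alpha> * x) * h (\<beta> * x)" for x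
  define G' where "G' x = exp (\<alpha> * x) * q (\<beta> * x)" for x
  have dG: "(G has_real_derivative G' x) (at x)" for x
    unfolding G_def G'_def q_def h_def
    by (auto intro!: derivative_eq_intros simp: algebra_simps)
  have G'_pos: "0 \<le> G' x" if "0 \<le> x" "x \<le> x\<^sub>1" for x
    unfolding G'_def using that \<beta> x\<^sub>1
    by (intro mult_nonneg_nonneg q_pos) (auto simp flip: x\<^sub>1(2))
  have G_mono: "G x \<le> G y" if "0 \<le> x" "x \<le> y" "y \<le> x\<^sub>1" for x y
    using that by (intro DERIV_nonneg_imp_nondecreasing[of x y G]) (auto intro!: exI dG G'_pos)
  have G_anti: "G x \<le> G x\<^sub>1" if "x\<^sub>1 \<le> x" for x
  proof (rule DERIV_nonpos_imp_nonincreasing[of x\<^sub>1 x G])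
    fix z assume "x\<^sub>1 \<le> z"
    then have "G' z \<le> 0" unfolding G'_def using \<beta>
      by (intro mult_nonneg_nonpos q_neg) (auto simp flip: x\<^sub>1(2))
    with dG show "\<exists>y. (G has_real_derivative y) (at z) \<and> y \<le> 0" by blast
  qed (fact that)
  define clamp where "clamp x = max 0 (min x x\<^sub>1)" for x
  have clamp: "0 \<le> clamp x" "clamp x \<le> x\<^sub>1" for x using x\<^sub>1 by (auto simp: clamp_def)
  have clamp_mono: "clamp x \<le> clamp y" "clamp y - clamp x \<le> y - x" if "x \<le> y" for x y
    using that by (auto simp: clamp_def)
  define g where "g x = G (clamp x)" for x
  define M where "M = G x\<^sub>1"
  have G_pos: "0 < G x" if "0 < x" "x \<le> x\<^sub>1" for x
  proof -
    have "\<beta> * x \<le> y\<^sub>1" using that \<beta> by (simp flip: x\<^sub>1(2))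
    then show ?thesis unfolding G_def h_def using y\<^sub>1' that \<beta> by simp
  qed
  have M: "0 < M" using G_pos x\<^sub>1 by (simp add: M_def)
  have g_mono: "g x \<le> g y" if "x \<le> y" for x y
    unfolding g_def using clamp clamp_mono that by (intro G_mono) auto
  have g_0: "g x = 0" if "x \<le> 0" for x
    using that x\<^sub>1 by (simp add: g_def clamp_def G_def h_def)
  have g_M: "g x = M" if "x\<^sub>1 \<le> x" for x
    using that x\<^sub>1 by (simp add: g_def clamp_def M_def)
  have g_nonneg: "0 \<le> g x" for x
    using g_mono[of 0 x] g_0[of 0] g_0[of x] by (cases "x \<le> 0") auto
  have g_le: "g x \<le> M" for x
    using g_mono[of x x\<^sub>1] g_M[of x\<^sub>1] g_M[of x] by (cases "x \<le> x\<^sub>1") auto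
  have g_ge: "G x \<le> g x" for x
  proof (cases "0 \<le> x")
    case True
    then show ?thesis using G_anti[of x] x\<^sub>1 by (cases "x \<le> x\<^sub>1") (auto simp: g_def clamp_def)
  next
    case False
    then have "\<beta> * x < 0" using \<beta> by (simp add: mult_pos_neg)
    then have "h (\<beta> * x) \<le> 0" unfolding h_def by (intro mult_nonpos_nonneg[of "\<beta> * x"]) linarith+
    then have "G x \<le> 0" unfolding G_def by (intro mult_nonneg_nonpos) auto
    then show ?thesis using g_nonneg[of x] by linarith
  qed
  define T where "T x = measure_pmf.expectation (geometric_pmf p) (\<lambda>X. g (x + 1 - real X))" for x
  have g_int: "integrable (geometric_pmf p) (\<lambda>X. g (x + 1 - real X))" for x
    by (rule integrable_geometric_bounded[where B = M]) (use g_nonneg g_le in auto)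
  have T_sums: "(\<lambda>k. (1 - p) ^ k * p * g (x + 1 - real k)) sums T x" for x
    unfolding T_def
  proof (rule expectation_geometric_sums[OF p])
    have "summable (\<lambda>k. M * p * (1 - p) ^ k)" using p by (intro summable_mult) auto
    then show "summable (\<lambda>k. (1 - p) ^ k * p * \<bar>g (x + 1 - real k)\<bar>)"
      by (rule summable_comparison_test'[where N = 0])
         (use p g_nonneg g_le in \<open>auto simp: abs_mult intro!: mult_left_mono\<close>)
  qed
  \<comment> \<open>Keeps only the term \<open>k = 0\<close>.\<close>
  have T_ge_p: "p * g (x + 1) \<le> T x" for x
  proof -
    have "(\<Sum>k\<in>{0}. (1 - p) ^ k * p * g (x + 1 - real k)) \<le> T x"
      unfolding sums_unique[OF T_sums]
      using p g_nonneg T_sums[of x] by (intro sum_le_suminf) (auto simp: sums_iff)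
    then show ?thesis by simp
  qed
  have T_nonneg: "0 \<le> T x" for x
    using T_ge_p[of x] p g_nonneg[of "x + 1"] by (meson order_trans less_imp_le mult_nonneg_nonneg)
  \<comment> \<open>Since \<open>h\<close> is quadratic, its Taylor expansion around \<open>\<beta> * x\<close> is exact for jumps of any size,
     and clipping \<open>G\<close> to \<open>g\<close> only increases the expectation.\<close>
  have T_ge: "exp (\<alpha> * x) * (C * q (\<beta> * x) - \<beta>\<^sup>2 * \<kappa>) \<le> T x" for x
  proof (rule sums_le[OF _ _ T_sums])
    let ?y = "\<beta> * x"
    have "(\<lambda>k. exp (\<alpha> * x) * (h ?y * w k + \<beta> * (1 - 2 * ?y) * (w k * (1 - real k))
        - \<beta>\<^sup>2 * (w k * (1 - real k)\<^sup>2))) sums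
      (exp (\<alpha> * x) * (h ?y * (C * \<alpha>) + \<beta> * (1 - 2 * ?y) * C - \<beta>\<^sup>2 * \<kappa>))"
      unfolding \<kappa>_def
      using s0 s1 summable_sums[OF s2] by (intro sums_mult sums_add sums_diff) (simp_all add: w_def)
    moreover have "exp (\<alpha> * x) * (h ?y * w k + \<beta> * (1 - 2 * ?y) * (w k * (1 - real k))
        - \<beta>\<^sup>2 * (w k * (1 - real k)\<^sup>2)) = (1 - p) ^ k * p * G (x + 1 - real k)" for k
    proof -
      have "exp (\<alpha> * (x + 1 - real k)) = exp (\<alpha> * x) * exp (\<alpha> * (1 - real k))"
        by (simp add: exp_add[symmetric] algebra_simps)
      then show ?thesis unfolding w_def G_def h_def by (simp add: algebra_simps power2_eq_square)
    qed
    ultimately show "(\<lambda>k. (1 - p) ^ k * p * G (x + 1 - real k)) sums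
        (exp (\<alpha> * x) * (C * q (\<beta> * x) - \<beta>\<^sup>2 * \<kappa>))"
      by (simp add: q_def algebra_simps)
    show "(1 - p) ^ k * p * G (x + 1 - real k) \<le> (1 - p) ^ k * p * g (x + 1 - real k)" for k
      using p g_ge by (intro mult_left_mono) auto
  qed
  \<comment> \<open>Two regimes: where \<open>q\<close> is not small, the first-order gain from
    \<open>c\<^sub>1 < C\<close> beats the Taylor error; otherwise \<open>x\<close> is near the peak
    and \<open>G'\<close> is so small that the jump \<open>k = 0\<close> alone dominates it.\<close>
  have key: "c\<^sub>1 * G' x \<le> T x" if x: "0 < x" "x < x\<^sub>1" for x
  proof -
    let ?y = "\<beta> * x"
    have y: "0 < ?y" "?y < y\<^sub>1" using x \<beta> by (auto simp flip: x\<^sub>1(2))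
    show ?thesis
    proof (cases "R * \<beta>\<^sup>2 \<le> q ?y")
      case True
      have "\<kappa> \<le> R * (C - c\<^sub>1)" using c\<^sub>1 by (simp add: R_def distrib_right)
      then have "\<beta>\<^sup>2 * \<kappa> \<le> (C - c\<^sub>1) * (R * \<beta>\<^sup>2)"
        using mult_right_mono[of \<kappa> "R * (C - c\<^sub>1)" "\<beta>\<^sup>2"] by (simp add: mult_ac)
      also have "\<dots> \<le> (C - c\<^sub>1) * q ?y" using True c\<^sub>1 by (intro mult_left_mono) auto
      finally have "c\<^sub>1 * q ?y \<le> C * q ?y - \<beta>\<^sup>2 * \<kappa>" by (simp add: algebra_simps)
      then have "exp (\<alpha> * x) * (c\<^sub>1 * q ?y) \<le> exp (\<alpha> * x) * (C * q ?y - \<beta>\<^sup>2 * \<kappa>)"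
        by (intro mult_left_mono) auto
      moreover have "c\<^sub>1 * G' x = exp (\<alpha> * x) * (c\<^sub>1 * q ?y)" by (simp add: G'_def)
      ultimately show ?thesis using T_ge[of x] by linarith
    next
      case False
      have R\<beta>: "R * \<beta>\<^sup>2 \<le> \<beta> / 4"
        using \<beta>2 \<beta> mult_right_mono[OF \<beta>2, of \<beta>] by (simp add: power2_eq_square mult_ac)
      have "3 / 4 < ?y"
      proof (rule ccontr)
        assume "\<not> 3 / 4 < ?y"
        then have y34: "?y \<le> 3 / 4" by simp
        have "R * \<beta>\<^sup>2 \<le> q ?y"
        proof (cases "?y \<le> 1 / 4")
          case True
          have "0 \<le> \<alpha> * h ?y" using \<alpha> y True by (auto simp: h_def)
          moreover have "\<beta> * (1 / 2) \<le> \<beta> * (1 - 2 * ?y)"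
            using True \<beta> by (intro mult_left_mono) auto
          ultimately show ?thesis using R\<beta> \<beta> unfolding q_def by linarith
        next
          case False
          have "0 \<le> (?y - 1 / 4) * (3 / 4 - ?y)" using False y34 by (intro mult_nonneg_nonneg) auto
          then have "3 / 16 \<le> h ?y" by (simp add: h_def algebra_simps)
          then have "\<alpha> * (3 / 16) \<le> \<alpha> * h ?y" using \<alpha> by (intro mult_left_mono) auto
          moreover have "\<beta> * (- (1 / 2)) \<le> \<beta> * (1 - 2 * ?y)"
            using y34 \<beta> by (intro mult_left_mono) auto
          ultimately show ?thesis using R\<beta> \<beta>1 \<beta> unfolding q_def by linarith
        qed
        with False show False by simp
      qed
      then have "\<beta> * (1 - 2 * ?y) \<le> \<beta> * (- (1 / 2))" using \<beta> by (intro mult_left_mono) auto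
      moreover have "0 \<le> q ?y" using y by (intro q_pos) auto
      ultimately have h: "\<beta> / 2 \<le> \<alpha> * h ?y" unfolding q_def by linarith
      have "c\<^sub>1 * q ?y \<le> c\<^sub>1 * (R * \<beta>\<^sup>2)" using False c\<^sub>1 by (intro mult_left_mono) auto
      also have "\<dots> = (2 * \<alpha> * c\<^sub>1 * R * \<beta>) * (\<beta> / 2) / \<alpha>"
        using \<alpha> by (simp add: power2_eq_square)
      also have "\<dots> \<le> p * (\<alpha> * h ?y) / \<alpha>"
        using \<alpha> \<beta> p h \<beta>3 by (intro divide_right_mono mult_mono) auto
      also have "\<dots> = p * h ?y" using \<alpha> by simp
      finally have "exp (\<alpha> * x) * (c\<^sub>1 * q ?y) \<le> exp (\<alpha> * x) * (p * h ?y)"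
        by (intro mult_left_mono) auto
      then have "c\<^sub>1 * G' x \<le> p * G x" by (simp add: G'_def G_def mult_ac)
      also have "\<dots> = p * g x" using x by (simp add: g_def clamp_def)
      also have "\<dots> \<le> p * g (x + 1)" using p g_mono by (intro mult_left_mono) auto
      finally show ?thesis using T_ge_p[of x] by linarith
    qed
  qed
  \<comment> \<open>\<open>g\<close> has a kink at \<open>0\<close>, so the mean value theorem is
    applied to \<open>G\<close> between the clamped points; this also keeps \<xi> strictly inside
    the interval where \<open>key\<close> holds.\<close>
  have mvt: "\<exists>\<xi>. clamp x < \<xi> \<and> \<xi> < clamp y \<and> g y - g x = (clamp y - clamp x) * G' \<xi>"
    if "clamp x < clamp y" for x y
    unfolding g_def using MVT2[of "clamp x" "clamp y" G G'] that dG by blast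
  have "continuous_on {0..x\<^sub>1} G'" unfolding G'_def q_def h_def by (intro continuous_intros)
  then obtain L where L: "\<And>x. x \<in> {0..x\<^sub>1} \<Longrightarrow> G' x \<le> L"
    using continuous_attains_sup[of "{0..x\<^sub>1}" G'] x\<^sub>1 by force
  define L' where "L' = max L 1"
  have L': "0 < L'" "\<And>x. 0 \<le> x \<Longrightarrow> x \<le> x\<^sub>1 \<Longrightarrow> G' x \<le> L'"
    using L by (auto simp: L'_def le_max_iff_disj)
  have g_lip: "g y - g x \<le> L' * (y - x)" if "x \<le> y" for x y
  proof (cases "clamp x < clamp y")
    case True
    from mvt[OF this] obtain \<xi> where \<xi>: "clamp x < \<xi>" "\<xi> < clamp y"
      "g y - g x = (clamp y - clamp x) * G' \<xi>" by blast
    have "0 \<le> \<xi>" "\<xi> \<le> x\<^sub>1" using \<xi> clamp[of x] clamp[of y] by auto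
    then have "g y - g x \<le> (y - x) * L'" unfolding \<xi>(3)
      using True clamp_mono[OF that] that G'_pos L' by (intro mult_mono) auto
    then show ?thesis by (simp add: mult_ac)
  next
    case False
    then have "clamp x = clamp y" using clamp_mono[OF that] by simp
    then show ?thesis using that L' by (simp add: g_def)
  qed
  \<comment> \<open>When \<open>x + e > 0\<close>, the bound \<open>1 / 2\<close> gives
    \<open>x + 1 \<ge> 1 / 2\<close>, hence \<open>T x \<ge> p * g (1 / 2)\<close>; the other bound
    then fits the Lipschitz error \<open>c * L' * e\<close> into
    \<open>(c\<^sub>1 - c) * T x\<close>.\<close>
  define e\<^sub>0 where "e\<^sub>0 = min (1 / 2) ((c\<^sub>1 - c) * (p * g (1 / 2)) / (c * L'))"
  have g_half: "0 < g (1 / 2)"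
    unfolding g_def using x\<^sub>1 by (intro G_pos) (auto simp: clamp_def)
  have e\<^sub>0: "0 < e\<^sub>0" unfolding e\<^sub>0_def using c c\<^sub>1 p g_half L' by simp
  have "c * (g (x + e) - g x) \<le> e * T x" if e: "0 \<le> e" "e \<le> e\<^sub>0" for x e
  proof (cases "clamp x < clamp (x + e)")
    case True
    from mvt[OF this] obtain \<xi> where \<xi>: "clamp x < \<xi>" "\<xi> < clamp (x + e)"
      "g (x + e) - g x = (clamp (x + e) - clamp x) * G' \<xi>" by blast
    have \<xi>': "0 < \<xi>" "\<xi> < x\<^sub>1" "\<xi> \<le> x + e" "0 < x + e"
      using \<xi> x\<^sub>1 by (auto simp: clamp_def split: if_splits)
    have "T \<xi> \<le> measure_pmf.expectation (geometric_pmf p) (\<lambda>X. g (x + 1 - real X) + L' * e)"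
      unfolding T_def
    proof (intro integral_mono g_int Bochner_Integration.integrable_add)
      fix k
      show "g (\<xi> + 1 - real k) \<le> g (x + 1 - real k) + L' * e"
        using g_mono[of "\<xi> + 1 - real k" "x + e + 1 - real k"] \<xi>'
          g_lip[of "x + 1 - real k" "x + e + 1 - real k"] e by simp
    qed auto
    also have "\<dots> = T x + L' * e" unfolding T_def
      by (subst Bochner_Integration.integral_add) (use g_int in auto)
    finally have T\<xi>: "T \<xi> \<le> T x + L' * e" .
    have "p * g (1 / 2) \<le> p * g (x + 1)"
      using p e \<xi>' by (intro mult_left_mono g_mono) (auto simp: e\<^sub>0_def)
    with T_ge_p[of x] have Tx: "p * g (1 / 2) \<le> T x" by linarith
    have "c * L' * e \<le> c * L' * ((c\<^sub>1 - c) * (p * g (1 / 2)) / (c * L'))"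
      using e c L' by (intro mult_left_mono) (auto simp: e\<^sub>0_def)
    also have "\<dots> = (c\<^sub>1 - c) * (p * g (1 / 2))" using c L' by simp
    also have "\<dots> \<le> (c\<^sub>1 - c) * T x" using Tx c\<^sub>1 by (intro mult_left_mono) auto
    finally have "c * (T x + L' * e) \<le> c\<^sub>1 * T x" by (simp add: algebra_simps)
    have "g (x + e) - g x \<le> e * G' \<xi>" unfolding \<xi>(3)
      using clamp_mono(2)[of x "x + e"] e G'_pos[of \<xi>] \<xi>' by (intro mult_right_mono) auto
    then have "c\<^sub>1 * (g (x + e) - g x) \<le> e * (c\<^sub>1 * G' \<xi>)"
      using c\<^sub>1 mult_left_mono[of "g (x + e) - g x" "e * G' \<xi>" c\<^sub>1] by (simp add: mult_ac)
    also have "\<dots> \<le> e * (T x + L' * e)"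
      using e key[OF \<xi>'(1,2)] T\<xi> by (intro mult_left_mono) auto
    finally have "c * (c\<^sub>1 * (g (x + e) - g x)) \<le> c * (e * (T x + L' * e))"
      using c by (intro mult_left_mono) auto
    also have "\<dots> = e * (c * (T x + L' * e))" by (simp add: mult_ac)
    also have "\<dots> \<le> e * (c\<^sub>1 * T x)"
      using \<open>c * (T x + L' * e) \<le> c\<^sub>1 * T x\<close> e by (intro mult_left_mono) auto
    finally have "c\<^sub>1 * (c * (g (x + e) - g x)) \<le> c\<^sub>1 * (e * T x)" by (simp add: mult_ac)
    then show ?thesis using c\<^sub>1 by simp
  next
    case False
    then have "clamp x = clamp (x + e)" using clamp_mono(1)[of x "x + e"] e by simp
    then show ?thesis using e T_nonneg by (simp add: g_def)
  qed
  with M e\<^sub>0 g_mono g_0 g_M g_nonneg g_le that[of M e\<^sub>0 g x\<^sub>1] show thesis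
    unfolding T_def mono_def by blast
qed

subsection \<open>The constants\<close>

text \<open>\<open>F\<close> is increasing, but \<open>x * F x\<close> may decrease while
  \<open>F\<close> is negative. Growth from a point where the product is at least \<open>1\<close>
  suffices for uniqueness and for \<open>s_param_ge\<close>.\<close>

lemma
  assumes p: "0 < p" "p < 1"
  shows s_param_pos: "0 < s_param p" and s_param_less_1: "s_param p < 1"
    and s_param_eq: "s_param p * ln ((1 - p) * (2 - s_param p) / (1 - s_param p)) = 1"
    and s_param_ge: "\<And>x. 0 < x \<Longrightarrow> x < 1 \<Longrightarrow>
      x * ln ((1 - p) * (2 - x) / (1 - x)) \<le> 1 \<Longrightarrow> x \<le> s_param p"
proof -
  define F where "F x = ln ((1 - p) * (2 - x) / (1 - x))" for x
  have F_mono: "F x < F y" if "x < y" "y < 1" for x y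
  proof -
    have "(2 - x) / (1 - x) < (2 - y) / (1 - y)" using that by (simp add: field_simps)
    then have "(1 - p) * (2 - x) / (1 - x) < (1 - p) * (2 - y) / (1 - y)"
      using mult_strict_left_mono[of "(2 - x) / (1 - x)" "(2 - y) / (1 - y)" "1 - p"] p by simp
    then show ?thesis unfolding F_def using that p by (subst ln_less_cancel_iff) auto
  qed
  have less: "x * F x < y * F y" if "0 < x" "x < y" "y < 1" "x * F x \<ge> 1" for x y
  proof -
    have "0 < F x"
    proof (rule ccontr)
      assume "\<not> 0 < F x"
      then have "x * F x \<le> 0" using that by (simp add: mult_nonneg_nonpos)
      with that show False by linarith
    qed
    then show ?thesis using that F_mono[of x y] by (intro mult_strict_mono) auto
  qed
  \<comment> \<open>Makes the argument of the logarithm \<open>(2 - b) * exp 2\<close>, so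
    \<open>F b \<ge> 2\<close>, while \<open>b \<ge> 1 / 2\<close>.\<close>
  define b where "b = 1 - (1 - p) * exp (-2)"
  have e2: "exp (-2 :: real) \<le> 1 / 2"
    using exp_ge_add_one_self[of 2] by (simp add: exp_minus field_simps)
  have "(1 - p) * exp (-2) \<le> 1 * (1 / 2)" using p e2 by (intro mult_mono) auto
  then have b: "1 / 2 \<le> b" "b < 1" using p by (auto simp: b_def)
  have cont: "continuous_on {1 / 2..b} (\<lambda>x. x * F x)"
    unfolding F_def using b p by (intro continuous_intros) auto
  have "1 / 2 * F (1 / 2) \<le> 1"
  proof -
    have "F (1 / 2) \<le> (1 - p) * (2 - 1 / 2) / (1 - 1 / 2) - 1"
      unfolding F_def using p by (intro ln_le_minus_one) auto
    also have "\<dots> = 2 - 3 * p" by (simp add: field_simps)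
    finally show ?thesis using p by simp
  qed
  moreover have "1 \<le> b * F b"
  proof -
    have "exp 2 \<le> (1 - p) * (2 - b) / (1 - b)"
    proof -
      have "1 - b = (1 - p) / exp 2" by (simp add: b_def exp_minus divide_inverse)
      then have "(1 - p) * (2 - b) / (1 - b) = (2 - b) * exp 2" using p by simp
      with mult_right_mono[of 1 "2 - b" "exp 2"] b show ?thesis by simp
    qed
    then have "ln (exp 2) \<le> F b" unfolding F_def by (intro ln_mono) (auto intro: less_le_trans[OF exp_gt_zero])
    then have "1 / 2 * 2 \<le> b * F b" using b by (intro mult_mono) auto
    then show ?thesis by simp
  qed
  ultimately obtain s where s: "1 / 2 \<le> s" "s \<le> b" "s * F s = 1"
    using IVT'[of "\<lambda>x. x * F x" "1 / 2" 1 b] b cont by auto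
  have uniq: "s' = s" if "0 < s'" "s' < 1" "s' * F s' = 1" for s'
    using less[of s s'] less[of s' s] that s b by (cases s s' rule: linorder_cases) auto
  have "s_param p = s" unfolding s_param_def
    by (rule the_equality) (use s b uniq in \<open>auto simp: F_def\<close>)
  then show "0 < s_param p" "s_param p < 1"
    "s_param p * ln ((1 - p) * (2 - s_param p) / (1 - s_param p)) = 1"
    using s b by (auto simp: F_def)
  show "x \<le> s_param p" if "0 < x" "x < 1" "x * ln ((1 - p) * (2 - x) / (1 - x)) \<le> 1" for x
  proof (rule ccontr)
    assume "\<not> x \<le> s_param p"
    then have "s * F s < x * F x" using that s \<open>s_param p = s\<close> by (intro less) auto
    then show False using that s by (simp add: F_def)
  qed
qed

text \<open>Exponentiating the equation for \<open>s\<close> makes the tilted ratio rational in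
  \<open>s\<close>, so that the tilted sums simplify to \<open>c_L p\<close>.\<close>

lemma
  assumes "0 < p" "p < 1"
  shows exp_inverse_s_param:
      "exp (1 / s_param p) = (1 - p) * (2 - s_param p) / (1 - s_param p)"
    and tilt_s_param: "(1 - p) * exp (- (1 / s_param p)) = (1 - s_param p) / (2 - s_param p)"
    and c_L_pos: "0 < c_L p"
proof -
  note s = s_param_pos[OF assms] s_param_less_1[OF assms] s_param_eq[OF assms]
  have "1 / s_param p = ln ((1 - p) * (2 - s_param p) / (1 - s_param p))"
    using s by (simp add: field_simps)
  then show *: "exp (1 / s_param p) = (1 - p) * (2 - s_param p) / (1 - s_param p)"
    using s assms by simp
  show "(1 - p) * exp (- (1 / s_param p)) = (1 - s_param p) / (2 - s_param p)"
  proof -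
    have "a * inverse (a * b / c) = c / b" if "a \<noteq> 0" for a b c :: real
      using that by (simp add: field_simps)
    then show ?thesis unfolding exp_minus * using assms by simp
  qed
  show "0 < c_L p" unfolding c_L_def using s assms by simp
qed

text \<open>With \<open>\<phi>(\<alpha>) = E exp (\<alpha> * (1 - Geo p))\<close>, the point \<open>\<alpha> = 1/s\<close> minimises
  \<open>\<phi>(\<alpha>) / \<alpha>\<close>, so that \<open>\<phi>(\<alpha>) / \<alpha> = \<phi>'(\<alpha>) = c_L p\<close>.\<close>

lemma
  assumes "0 < p" "p < 1"
  defines "\<alpha> \<equiv> 1 / s_param p"
  shows c_L_sums_0: "(\<lambda>k. (1 - p) ^ k * p * exp (\<alpha> * (1 - real k))) sums (c_L p * \<alpha>)"
    and c_L_sums_1: "(\<lambda>k. (1 - p) ^ k * p * exp (\<alpha> * (1 - real k)) * (1 - real k)) sums c_L p"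
proof -
  define s where "s = s_param p"
  have s: "0 < s" "s < 1" using s_param_pos s_param_less_1 assms by (auto simp: s_def)
  have \<alpha>: "0 < \<alpha>" using s by (simp add: \<alpha>_def s_def)
  have r: "(1 - p) * exp (- \<alpha>) = (1 - s) / (2 - s)"
    using tilt_s_param[OF assms(1,2)] by (simp add: \<alpha>_def s_def)
  have r1: "1 - (1 - s) / (2 - s) = 1 / (2 - s)" "1 - 2 * ((1 - s) / (2 - s)) = s / (2 - s)"
    using s by (simp_all add: field_simps)
  have "p * exp \<alpha> / (1 / (2 - s)) = c_L p * \<alpha>"
    unfolding c_L_def using s by (simp add: \<alpha>_def s_def[symmetric])
  with tilt_sums_0[OF assms(1,2) \<alpha>] show
    "(\<lambda>k. (1 - p) ^ k * p * exp (\<alpha> * (1 - real k))) sums (c_L p * \<alpha>)"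
    by (simp only: r r1)
  have "p * exp \<alpha> * (s / (2 - s)) / (1 / (2 - s))\<^sup>2 = c_L p"
    unfolding c_L_def using s by (simp add: \<alpha>_def s_def[symmetric] power2_eq_square)
  with tilt_sums_1[OF assms(1,2) \<alpha>] show
    "(\<lambda>k. (1 - p) ^ k * p * exp (\<alpha> * (1 - real k)) * (1 - real k)) sums c_L p"
    by (simp only: r r1)
qed

text \<open>The right side minus the left side is strictly increasing on \<open>(0, 1/2)\<close>, so
  its zero \<open>p0\<close> is unique and its sign beyond \<open>p0\<close> is known.\<close>

lemma
  shows p0_less_half: "p0 < 1 / 2"
    and p0_le_imp: "\<And>q. p0 \<le> q \<Longrightarrow> q < 1 / 2 \<Longrightarrow> ln ((1 - q) / q) \<le> (1 - q) / (1 - 2 * q)"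
proof -
  define F :: "real \<Rightarrow> real" where "F q = (1 - q) / (1 - 2 * q) - ln ((1 - q) / q)" for q
  have F_less: "F x < F y" if "0 < x" "x < y" "y < 1 / 2" for x y
  proof -
    have "(1 - y) / y < (1 - x) / x" using that by (simp add: field_simps)
    then have "ln ((1 - y) / y) < ln ((1 - x) / x)"
      using that by (subst ln_less_cancel_iff) auto
    moreover have "(1 - x) / (1 - 2 * x) < (1 - y) / (1 - 2 * y)"
      using that by (simp add: field_simps)
    ultimately show ?thesis by (simp add: F_def)
  qed
  \<comment> \<open>The points where \<open>(1 - q) / q\<close> is \<open>exp 2\<close> and
    \<open>exp 1\<close>; there \<open>F\<close> equals \<open>E / (E - 1) - 2\<close> and
    \<open>E / (E - 1) - 1\<close> with \<open>E\<close> the respective exponential.\<close>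
  define a b :: real where "a = 1 / (1 + exp 2)" and "b = 1 / (1 + exp 1)"
  have e: "3 \<le> exp (2 :: real)" "2 \<le> exp (1 :: real)" "exp 1 < exp (2 :: real)"
    using exp_ge_add_one_self[of 2] exp_ge_add_one_self[of 1] by auto
  have ab: "0 < a" "a \<le> b" "b < 1 / 2"
    using e by (auto simp: a_def b_def intro!: divide_left_mono simp: field_simps)
  have ratio: "(1 - x) / x = E" "(1 - x) / (1 - 2 * x) = E / (E - 1)"
    if "1 < E" "x = 1 / (1 + E)" for x E :: real
  proof -
    have "1 - x = E / (1 + E)" "1 - 2 * x = (E - 1) / (1 + E)"
      using that by (simp_all add: field_simps)
    then show "(1 - x) / x = E" "(1 - x) / (1 - 2 * x) = E / (E - 1)"
      using that by simp_all
  qed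
  have "F a \<le> 0"
  proof -
    have "(1 - a) / a = exp 2" "(1 - a) / (1 - 2 * a) = exp 2 / (exp 2 - 1)"
      using e a_def by (intro ratio; simp)+
    then have "F a = exp 2 / (exp 2 - 1) - 2" by (simp only: F_def ln_exp)
    then show ?thesis using e by (simp add: divide_le_eq)
  qed
  moreover have "0 \<le> F b"
  proof -
    have "(1 - b) / b = exp 1" "(1 - b) / (1 - 2 * b) = exp 1 / (exp 1 - 1)"
      using e b_def by (intro ratio; simp)+
    then have "F b = exp 1 / (exp 1 - 1) - 1" by (simp only: F_def ln_exp)
    then show ?thesis using e by (simp add: le_divide_eq)
  qed
  moreover have "continuous_on {a..b} F"
    unfolding F_def using ab by (intro continuous_intros) auto
  ultimately obtain q where q: "a \<le> q" "q \<le> b" "F q = 0"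
    using IVT'[of F a 0 b] ab by auto
  have uniq: "q' = q" if "0 < q'" "q' < 1 / 2" "F q' = 0" for q'
    using F_less[of q q'] F_less[of q' q] that q ab by (cases q q' rule: linorder_cases) auto
  have "p0 = q" unfolding p0_def
    by (rule the_equality) (use q ab uniq in \<open>auto simp: F_def\<close>)
  then show "p0 < 1 / 2" using q ab by simp
  show "ln ((1 - x) / x) \<le> (1 - x) / (1 - 2 * x)" if "p0 \<le> x" "x < 1 / 2" for x
    using F_less[of q x] that \<open>p0 = q\<close> q ab by (cases "x = q") (auto simp: F_def)
qed

text \<open>Two growth rates compete in the upper bound: \<phi> from walks that stop before
  overshooting the root, and \<open>1\<close> from the constant contribution of the others. One tilt
  has to cover both.\<close>

lemma c_U_exponent:
  assumes p: "0 < p" "p < 1"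
  obtains \<alpha> \<phi> where "0 < \<alpha>" "(\<lambda>k. (1 - p) ^ k * p * exp (\<alpha> * (1 - real k))) sums \<phi>"
    "\<phi> \<le> c_U p * \<alpha>" "1 \<le> c_U p * \<alpha>"
proof (cases "p0 \<le> p")
  case True
  define s where "s = s_param p"
  have s: "0 < s" "s < 1" using s_param_pos s_param_less_1 p by (auto simp: s_def)
  have s_ge: "1 - 2 * p \<le> s * (1 - p)"
  proof (cases "p < 1 / 2")
    case False
    have "0 \<le> s * (1 - p)" using s p by simp
    with False show ?thesis by linarith
  next
    case half: True
    \<comment> \<open>At this point the logarithm in the equation for \<open>s\<close> is
      \<open>ln ((1 - p) / p)\<close>, so the inequality valid beyond \<open>p0\<close> says exactly
      that the left side is at most \<open>1\<close>.\<close>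
    let ?x = "(1 - 2 * p) / (1 - p)"
    have x: "0 < ?x" "?x < 1" using half p by (auto simp: field_simps)
    have "(1 - p) * (2 - ?x) / (1 - ?x) = (1 - p) / p"
      using p by (simp add: field_simps)
    moreover have "?x * ln ((1 - p) / p) \<le> ?x * ((1 - p) / (1 - 2 * p))"
      using p0_le_imp[OF True half] x by (intro mult_left_mono) auto
    moreover have "?x * ((1 - p) / (1 - 2 * p)) = 1" using half p by simp
    ultimately have "?x \<le> s" unfolding s_def using x by (intro s_param_ge p) auto
    then show ?thesis using p by (simp add: field_simps)
  qed
  \<comment> \<open>This is \<phi>(1/s) \<ge> 1. With \<open>u = p * (2 - s)\<close> and
    \<open>v = (1 - p) * (2 - s)\<close> one has \<open>u + v = 2 - s\<close>, so it amounts to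
    \<open>(1 - u) * (1 - v) \<ge> 0\<close>; \<open>s_ge\<close> gives \<open>v \<le> 1\<close>,
    and \<open>exp (1 / s) > 1\<close> gives \<open>u \<le> 1\<close>.\<close>
  have "1 \<le> p * (2 - s) * ((1 - p) * (2 - s) / (1 - s))"
  proof -
    have B: "(1 - p) * (2 - s) \<le> 1" using s_ge by (simp add: algebra_simps)
    have "1 < exp (1 / s)" using s by simp
    then have "1 < (1 - p) * (2 - s) / (1 - s)"
      unfolding s_def exp_inverse_s_param[OF p] .
    then have "1 - s < (1 - p) * (2 - s)" using s by (simp add: less_divide_eq)
    then have "p * (2 - s) \<le> 1" by (simp add: algebra_simps)
    with B have "0 \<le> (1 - p * (2 - s)) * (1 - (1 - p) * (2 - s))"
      by (intro mult_nonneg_nonneg) auto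
    then have "1 - s \<le> p * (2 - s) * ((1 - p) * (2 - s))"
      by (simp add: algebra_simps)
    then show ?thesis using s by (simp add: field_simps)
  qed
  then have "1 \<le> c_L p * (1 / s)"
    using s exp_inverse_s_param[OF p] by (simp add: c_L_def s_def[symmetric] mult_ac)
  with that[of "1 / s" "c_L p * (1 / s)"] c_L_sums_0[OF p] s True show ?thesis
    by (simp add: s_def c_U_def)
next
  case False
  define z where "z = (1 - p) / p"
  have half: "p < 1 / 2" using False p0_less_half by simp
  have z: "1 < z" using p half by (simp add: z_def field_simps)
  have "(1 - p) * exp (- ln z) = p" "p * exp (ln z) = 1 - p"
    using z p by (simp_all add: exp_minus z_def field_simps)
  then have "(\<lambda>k. (1 - p) ^ k * p * exp (ln z * (1 - real k))) sums 1"
    using tilt_sums_0[OF p, of "ln z"] z p by simp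
  with that[of "ln z" 1] z False show ?thesis by (simp add: c_U_def z_def)
qed

subsection \<open>Upper bound\<close>

text \<open>For \<open>X \<le> d\<close> the new depth is exactly \<open>d + 1 - X\<close>; an
  overshooting walk gives depth \<open>1\<close>, at cost \<open>exp \<alpha>\<close>.\<close>

lemma expectation_step_exp_depth:
  fixes \<alpha> \<phi> :: real
  assumes p: "0 < p" "p < 1" and \<alpha>: "0 < \<alpha>"
    and \<phi>: "(\<lambda>k. (1 - p) ^ k * p * exp (\<alpha> * (1 - real k))) sums \<phi>"
  shows "integrable (geometric_pmf p) (\<lambda>X. exp (\<alpha> * real (Suc (d - X))))"
    and "measure_pmf.expectation (geometric_pmf p) (\<lambda>X. exp (\<alpha> * real (Suc (d - X))))
      \<le> \<phi> * exp (\<alpha> * real d) + exp \<alpha>"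
proof -
  let ?f = "\<lambda>X. exp (\<alpha> * real (Suc (d - X)))"
  let ?h = "\<lambda>X. exp (\<alpha> * real d) * exp (\<alpha> * (1 - real X))"
  show i: "integrable (geometric_pmf p) ?f"
    by (rule integrable_geometric_bounded[where B = "exp (\<alpha> * real (Suc d))"]) (use \<alpha> in auto)
  have h: "(\<lambda>k. (1 - p) ^ k * p * ?h k) sums (exp (\<alpha> * real d) * \<phi>)"
    using sums_mult[OF \<phi>, of "exp (\<alpha> * real d)"] by (simp add: mult_ac)
  then have s: "summable (\<lambda>k. (1 - p) ^ k * p * \<bar>?h k\<bar>)" by (simp add: sums_iff abs_mult)
  note ih = integrable_geometric[OF p s] and eh = expectation_geometric_sums[OF p s]
  have "measure_pmf.expectation (geometric_pmf p) ?f \<le>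
      measure_pmf.expectation (geometric_pmf p) (\<lambda>X. ?h X + exp \<alpha>)"
  proof (intro integral_mono i Bochner_Integration.integrable_add ih)
    fix k
    show "?f k \<le> ?h k + exp \<alpha>"
    proof (cases "k \<le> d")
      case True
      then show ?thesis
        by (simp add: exp_add[symmetric] of_nat_diff algebra_simps)
    next
      case False
      then show ?thesis by simp
    qed
  qed auto
  also have "\<dots> = exp (\<alpha> * real d) * \<phi> + exp \<alpha>"
    using sums_unique2[OF eh h] ih by (subst Bochner_Integration.integral_add) auto
  finally show "measure_pmf.expectation (geometric_pmf p) ?f \<le> \<phi> * exp (\<alpha> * real d) + exp \<alpha>"
    by (simp add: mult_ac)
qed

text \<open>Turns the growth factor \<open>1 + \<psi> / n\<close> into the ratio of consecutive
  powers with exponent \<psi>.\<close>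

lemma Bernoulli_powr:
  fixes x a :: real
  assumes "0 \<le> x" "1 \<le> a"
  shows "1 + a * x \<le> (1 + x) powr a"
proof -
  have "(1 + 0) powr a - a * 0 \<le> (1 + x) powr a - a * x"
  proof (rule DERIV_nonneg_imp_nondecreasing[of 0 x "\<lambda>x. (1 + x) powr a - a * x"])
    fix y :: real assume "0 \<le> y"
    then have "((\<lambda>x. (1 + x) powr a - a * x) has_real_derivative a * (1 + y) powr (a - 1) - a) (at y)"
      by (auto intro!: derivative_eq_intros)
    moreover have "1 \<le> (1 + y) powr (a - 1)"
      using \<open>0 \<le> y\<close> assms by (intro ge_one_powr_ge_zero) auto
    then have "0 \<le> a * (1 + y) powr (a - 1) - a"
      using assms mult_left_mono[of 1 "(1 + y) powr (a - 1)" a] by simp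
    ultimately show "\<exists>D. ((\<lambda>x. (1 + x) powr a - a * x) has_real_derivative D) (at y) \<and> 0 \<le> D"
      by blast
  qed (use assms in auto)
  then show ?thesis by simp
qed

text \<open>In \<open>A\<close>, the \<open>1\<close> covers the single root, and the quotient lets
  the slack \<psi> - \<phi> absorb the source term \<open>exp \<alpha>\<close>.\<close>

lemma exp_depth_moment_growth:
  fixes \<alpha> \<phi> \<psi> :: real
  assumes p: "0 < p" "p < 1" and \<alpha>: "0 < \<alpha>"
    and \<phi>: "(\<lambda>k. (1 - p) ^ k * p * exp (\<alpha> * (1 - real k))) sums \<phi>"
    and \<psi>: "\<phi> < \<psi>" "1 < \<psi>"
  defines "A \<equiv> max 1 (exp \<alpha> / (\<psi> - \<phi>))"
  shows "(\<integral>\<^sup>+t. ennreal (depth_sum (\<lambda>d. exp (\<alpha> * real d)) t) \<partial>rs_graph p k) \<le>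
    ennreal (A * real (Suc k) powr \<psi>)"
proof (induction k)
  case 0
  show ?case by (simp add: depth_sum_def A_def nn_integral_return_pmf)
next
  case (Suc k)
  let ?f = "\<lambda>d. exp (\<alpha> * real d)" and ?n = "real (Suc k)"
  have \<phi>0: "0 \<le> \<phi>" using sums_le[OF _ sums_zero \<phi>] p by simp
  have step: "(\<integral>\<^sup>+t'. ennreal (depth_sum ?f t') \<partial>rs_step p t) \<le>
      ennreal (1 + \<phi> / ?n) * ennreal (depth_sum ?f t) + ennreal (exp \<alpha>)"
    if "t \<in> set_pmf (rs_graph p k)" for t
  proof -
    from set_pmf_rs_graph[OF that] have t: "rec_tree t" "length t = Suc k" by auto
    have S: "0 \<le> depth_sum ?f t" by (simp add: depth_sum_nonneg)
    note E = expectation_step_exp_depth[OF p \<alpha> \<phi>]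
    have "(\<integral>\<^sup>+t'. ennreal (depth_sum ?f t') \<partial>rs_step p t) =
      ennreal ((\<Sum>u<Suc k. measure_pmf.expectation (geometric_pmf p)
        (\<lambda>X. depth_sum ?f t + ?f (Suc (depth t u - X)))) / ?n)"
      using t E(1) by (subst nn_integral_rs_step)
        (auto simp: depth_sum_nonneg depth_sum_attach simp del: of_nat_Suc sum.lessThan_Suc)
    also have "\<dots> \<le> ennreal ((\<Sum>u<Suc k. depth_sum ?f t + (\<phi> * ?f (depth t u) + exp \<alpha>)) / ?n)"
    proof (intro ennreal_leI divide_right_mono sum_mono)
      fix u
      show "measure_pmf.expectation (geometric_pmf p)
        (\<lambda>X. depth_sum ?f t + ?f (Suc (depth t u - X))) \<le>
        depth_sum ?f t + (\<phi> * ?f (depth t u) + exp \<alpha>)"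
        using E(2)[of "depth t u"]
        by (subst Bochner_Integration.integral_add[OF _ E(1)]) auto
    qed simp
    also have "(\<Sum>u<Suc k. depth_sum ?f t + (\<phi> * ?f (depth t u) + exp \<alpha>)) / ?n =
        (1 + \<phi> / ?n) * depth_sum ?f t + exp \<alpha>"
      using t unfolding sum.distrib sum_distrib_left[symmetric]
      by (simp add: depth_sum_def field_simps del: sum.lessThan_Suc)
    also have "ennreal \<dots> = ennreal (1 + \<phi> / ?n) * ennreal (depth_sum ?f t) + ennreal (exp \<alpha>)"
      using S \<phi>0 by (simp add: ennreal_plus ennreal_mult del: ennreal_plus[symmetric])
    finally show ?thesis .
  qed
  have "(\<integral>\<^sup>+t. ennreal (depth_sum ?f t) \<partial>rs_graph p (Suc k)) \<le>
      (\<integral>\<^sup>+t. ennreal (1 + \<phi> / ?n) * ennreal (depth_sum ?f t) + ennreal (exp \<alpha>) \<partial>rs_graph p k)"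
    unfolding rs_graph.simps nn_integral_bind_pmf
    by (intro nn_integral_mono_AE, unfold AE_measure_pmf_iff) (intro ballI step)
  also have "\<dots> = ennreal (1 + \<phi> / ?n) * (\<integral>\<^sup>+t. ennreal (depth_sum ?f t) \<partial>rs_graph p k) + ennreal (exp \<alpha>)"
    by (subst nn_integral_add) (auto simp: nn_integral_cmult)
  also have "\<dots> \<le> ennreal (1 + \<phi> / ?n) * ennreal (A * ?n powr \<psi>) + ennreal (exp \<alpha>)"
    using Suc.IH by (intro add_right_mono mult_left_mono) auto
  also have "\<dots> = ennreal ((1 + \<phi> / ?n) * (A * ?n powr \<psi>) + exp \<alpha>)"
    using \<phi>0 by (subst ennreal_plus) (auto simp: ennreal_mult A_def)
  \<comment> \<open>The gap between the two sides before adding \<open>exp \<alpha>\<close> is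
    \<open>A * (\<psi> - \<phi>) * n powr (\<psi> - 1)\<close>, and the power is at least
    \<open>1\<close> because \<psi> > 1.\<close>
  also have "(1 + \<phi> / ?n) * (A * ?n powr \<psi>) + exp \<alpha> \<le> A * (?n powr \<psi> * (1 + \<psi> / ?n))"
  proof -
    have "exp \<alpha> = (exp \<alpha> / (\<psi> - \<phi>)) * (\<psi> - \<phi>)" using \<psi> by simp
    also have "\<dots> \<le> A * (\<psi> - \<phi>)" using \<psi> by (intro mult_right_mono) (auto simp: A_def)
    also have "\<dots> \<le> A * (\<psi> - \<phi>) * (?n powr (\<psi> - 1))"
      using \<psi> ge_one_powr_ge_zero[of ?n "\<psi> - 1"] mult_left_mono[of 1 "?n powr (\<psi> - 1)" "A * (\<psi> - \<phi>)"]
      by (simp add: A_def)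
    also have "?n powr (\<psi> - 1) = ?n powr \<psi> / ?n" by (simp add: powr_diff)
    finally show ?thesis by (simp add: algebra_simps diff_divide_distrib)
  qed
  also have "?n powr \<psi> * (1 + \<psi> / ?n) \<le> ?n powr \<psi> * ((1 + 1 / ?n) powr \<psi>)"
  proof (intro mult_left_mono)
    show "1 + \<psi> / ?n \<le> (1 + 1 / ?n) powr \<psi>"
      using Bernoulli_powr[of "1 / ?n" \<psi>] \<psi> by simp
  qed auto
  also have "\<dots> = (?n * (1 + 1 / ?n)) powr \<psi>" by (rule powr_mult[symmetric])
  also have "?n * (1 + 1 / ?n) = real (Suc (Suc k))" by (simp add: field_simps)
  finally show ?case by (simp add: A_def ennreal_leI mult_left_mono)
qed

lemma prob_height_upper:
  fixes c \<epsilon> \<alpha> \<phi> :: real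
  assumes p: "0 < p" "p < 1" and \<alpha>: "0 < \<alpha>" and \<epsilon>: "0 < \<epsilon>"
    and \<phi>: "(\<lambda>k. (1 - p) ^ k * p * exp (\<alpha> * (1 - real k))) sums \<phi>"
    and c: "\<phi> \<le> c * \<alpha>" "1 \<le> c * \<alpha>"
  shows "(\<lambda>n. measure_pmf.prob (rs_tree p n) {t. (c + \<epsilon>) * ln (real n) < real (height t)})
    \<longlonglongrightarrow> 0"
proof (rule tendsto_sandwich[OF _ _ tendsto_const])
  \<comment> \<open>Half of \<epsilon> buys the strict inequalities for \<psi>; the other half
    remains as the decay rate in Markov's inequality.\<close>
  define \<psi> where "\<psi> = c * \<alpha> + \<epsilon> * \<alpha> / 2"
  have \<psi>: "\<phi> < \<psi>" "1 < \<psi>" using c \<alpha> \<epsilon> mult_pos_pos[OF \<epsilon> \<alpha>] unfolding \<psi>_def by linarith+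
  define A where "A = max 1 (exp \<alpha> / (\<psi> - \<phi>))"
  let ?f = "\<lambda>d. exp (\<alpha> * real d)"
  show "\<forall>\<^sub>F n in sequentially. measure_pmf.prob (rs_tree p n)
      {t. (c + \<epsilon>) * ln (real n) < real (height t)} \<le> A * real n powr (- (\<epsilon> * \<alpha> / 2))"
    using eventually_gt_at_top[of 0]
  proof eventually_elim
    case (elim n)
    let ?B = "{t. (c + \<epsilon>) * ln (real n) < real (height t)}"
    let ?w = "real n powr (- (\<alpha> * (c + \<epsilon>)))"
    have "emeasure (rs_tree p n) ?B = (\<integral>\<^sup>+t. indicator ?B t \<partial>rs_tree p n)" by simp
    also have "\<dots> \<le> (\<integral>\<^sup>+t. ennreal ?w * ennreal (depth_sum ?f t) \<partial>rs_tree p n)"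
    proof (intro nn_integral_mono_AE, unfold AE_measure_pmf_iff, intro ballI)
      fix t assume "t \<in> set_pmf (rs_tree p n)"
      then have t: "rec_tree t" using set_pmf_rs_graph by (auto simp: rs_tree_def)
      show "indicator ?B t \<le> ennreal ?w * ennreal (depth_sum ?f t)"
      proof (cases "t \<in> ?B")
        case True
        from height_attained[OF t] obtain v where v: "v < length t" "depth t v = height t" by blast
        have "?w * exp (\<alpha> * ((c + \<epsilon>) * ln (real n))) = 1"
          using elim by (simp add: powr_def exp_add[symmetric])
        moreover have "exp (\<alpha> * ((c + \<epsilon>) * ln (real n))) \<le> ?f (height t)"
          using True \<alpha> by simp
        moreover have "?f (height t) \<le> depth_sum ?f t"
          unfolding depth_sum_def v(2)[symmetric] using v by (intro member_le_sum) auto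
        ultimately have "1 \<le> ?w * depth_sum ?f t"
          by (metis order_trans mult_left_mono powr_ge_zero)
        then show ?thesis using True by (simp add: ennreal_mult[symmetric] depth_sum_nonneg)
      qed simp
    qed
    also have "\<dots> = ennreal ?w * (\<integral>\<^sup>+t. ennreal (depth_sum ?f t) \<partial>rs_tree p n)"
      by (simp add: nn_integral_cmult)
    also have "\<dots> \<le> ennreal ?w * ennreal (A * real n powr \<psi>)"
      using exp_depth_moment_growth[OF p \<alpha> \<phi> \<psi>, of "n - 1"] elim
      by (intro mult_left_mono) (auto simp: rs_tree_def A_def)
    also have "\<dots> = ennreal (A * real n powr (- (\<epsilon> * \<alpha> / 2)))"
      by (simp add: A_def ennreal_mult[symmetric] powr_add[symmetric] \<psi>_def algebra_simps)
    finally show ?case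
      by (simp add: measure_pmf.emeasure_eq_measure A_def)
  qed
  have "(\<lambda>n. real n powr (- (\<epsilon> * \<alpha> / 2))) \<longlonglongrightarrow> 0"
    using \<epsilon> \<alpha> by (intro tendsto_neg_powr filterlim_real_sequentially) auto
  from tendsto_mult_left[OF this, of A]
  show "(\<lambda>n. A * real n powr (- (\<epsilon> * \<alpha> / 2))) \<longlonglongrightarrow> 0" by simp
qed simp

subsection \<open>Lower bound\<close>

lemma nn_integral_rs_step_exp_neg:
  fixes f f' :: "nat \<Rightarrow> real"
  assumes t: "rec_tree t"
    and f': "\<And>d. 0 \<le> f' d" "\<And>d. f' d \<le> \<delta>" and \<delta>: "\<delta> \<le> 1"
    and f: "\<And>d. f d \<le> f' d + (1 - \<delta>) / length t *
      measure_pmf.expectation (geometric_pmf p) (\<lambda>X. f' (Suc (d - X)))"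
  shows "(\<integral>\<^sup>+t'. ennreal (exp (- depth_sum f' t')) \<partial>rs_step p t) \<le>
    ennreal (exp (- depth_sum f t))"
proof -
  let ?n = "real (length t)"
  let ?E = "\<lambda>u. measure_pmf.expectation (geometric_pmf p) (\<lambda>X. f' (Suc (depth t u - X)))"
  have n: "t \<noteq> []" "0 < ?n" using t by (auto simp: rec_tree_def)
  have int: "integrable (geometric_pmf p) (\<lambda>X. f' (Suc (d - X)))" for d
    by (rule integrable_geometric_bounded[where B = \<delta>]) (use f' in auto)
  have int_exp: "integrable (geometric_pmf p) (\<lambda>X. exp (- (a + f' (Suc (d - X)))))" for a d
    by (rule integrable_geometric_bounded[where B = "exp (- a)"]) (use f' in auto)
  \<comment> \<open>The factor \<open>1 - \<delta>\<close> pays for the quadratic error of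
    linearising on \<open>[0, \<delta>]\<close>.\<close>
  have exp_le: "exp (- y) \<le> 1 - (1 - \<delta>) * y" if "0 \<le> y" "y \<le> \<delta>" for y
  proof -
    have "(1 - \<delta>) * y \<le> 1" using that \<delta> by (intro mult_le_one) auto
    have "(1 - \<delta>) * y * y \<le> 1 * \<delta> * y"
      using that \<delta> by (intro mult_mono) (auto intro: mult_left_le_one_le)
    then have "1 \<le> (1 - (1 - \<delta>) * y) * (1 + y)" by (simp add: algebra_simps)
    also have "\<dots> \<le> (1 - (1 - \<delta>) * y) * exp y"
      using \<open>(1 - \<delta>) * y \<le> 1\<close> by (intro mult_left_mono exp_ge_add_one_self) auto
    finally show ?thesis by (simp add: exp_minus field_simps)
  qed
  have "(\<integral>\<^sup>+t'. ennreal (exp (- depth_sum f' t')) \<partial>rs_step p t) =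
      ennreal ((\<Sum>u<length t. measure_pmf.expectation (geometric_pmf p)
        (\<lambda>X. exp (- (depth_sum f' t + f' (Suc (depth t u - X)))))) / ?n)"
    using t n int_exp by (subst nn_integral_rs_step) (auto simp: depth_sum_attach simp del: minus_add_distrib)
  also have "\<dots> \<le> ennreal ((\<Sum>u<length t. exp (- depth_sum f' t) * (1 - (1 - \<delta>) * ?E u)) / ?n)"
  proof (intro ennreal_leI divide_right_mono sum_mono)
    fix u
    have "measure_pmf.expectation (geometric_pmf p)
        (\<lambda>X. exp (- (depth_sum f' t + f' (Suc (depth t u - X))))) \<le>
      measure_pmf.expectation (geometric_pmf p)
        (\<lambda>X. exp (- depth_sum f' t) * (1 - (1 - \<delta>) * f' (Suc (depth t u - X))))"
    proof (intro integral_mono int_exp)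
      show "exp (- (depth_sum f' t + f' (Suc (depth t u - X)))) \<le>
          exp (- depth_sum f' t) * (1 - (1 - \<delta>) * f' (Suc (depth t u - X)))" for X
        unfolding minus_add_distrib exp_add using f' by (intro mult_left_mono exp_le) auto
    qed (use int in simp)
    also have "\<dots> = exp (- depth_sum f' t) * (1 - (1 - \<delta>) * ?E u)"
      using int by simp
    finally show "measure_pmf.expectation (geometric_pmf p)
        (\<lambda>X. exp (- (depth_sum f' t + f' (Suc (depth t u - X))))) \<le>
      exp (- depth_sum f' t) * (1 - (1 - \<delta>) * ?E u)" .
  qed simp
  also have "(\<Sum>u<length t. exp (- depth_sum f' t) * (1 - (1 - \<delta>) * ?E u)) / ?n =
      exp (- depth_sum f' t) * (1 + - (\<Sum>u<length t. (1 - \<delta>) / ?n * ?E u))"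
  proof -
    have "(\<Sum>u<length t. 1 - (1 - \<delta>) * ?E u) = ?n * (1 + - (\<Sum>u<length t. (1 - \<delta>) / ?n * ?E u))"
      using n by (simp add: sum_subtractf sum_distrib_left right_diff_distrib)
    then show ?thesis using n unfolding sum_distrib_left[symmetric] by simp
  qed
  also have "\<dots> \<le> exp (- depth_sum f' t) * exp (- (\<Sum>u<length t. (1 - \<delta>) / ?n * ?E u))"
    by (intro mult_left_mono exp_ge_add_one_self) auto
  also have "\<dots> = exp (- (depth_sum f' t + (\<Sum>u<length t. (1 - \<delta>) / ?n * ?E u)))"
    by (simp add: exp_add[symmetric])
  also have "\<dots> \<le> exp (- depth_sum f t)"
    using sum_mono[of "{..<length t}" "\<lambda>u. f (depth t u)" "\<lambda>u. f' (depth t u) + (1 - \<delta>) / ?n * ?E u"] f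
    by (simp add: depth_sum_def sum.distrib)
  finally show ?thesis by (simp add: ennreal_leI)
qed

text \<open>If all depths are below \<open>h\<close>, the product at time \<open>n\<close> equals
  \<open>1\<close>, so its expectation bounds the probability; running back to time
  \<open>n\<^sub>0\<close>, where every vertex costs \<delta>, gives the value.\<close>

lemma prob_height_less_le:
  fixes f :: "nat \<Rightarrow> nat \<Rightarrow> real"
  assumes n: "0 < n\<^sub>0" "n\<^sub>0 \<le> n"
    and f: "\<And>k d. 0 \<le> f k d" "\<And>k d. f k d \<le> \<delta>" and \<delta>: "\<delta> \<le> 1"
    and step: "\<And>k d. n\<^sub>0 \<le> k \<Longrightarrow> f k d \<le> f (Suc k) d + (1 - \<delta>) / k *
      measure_pmf.expectation (geometric_pmf p) (\<lambda>X. f (Suc k) (Suc (d - X)))"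
    and start: "\<And>d. f n\<^sub>0 d = \<delta>"
    and final: "\<And>d. real d < h \<Longrightarrow> f n d = 0"
  shows "measure_pmf.prob (rs_tree p n) {t. real (height t) < h} \<le> exp (- (real n\<^sub>0 * \<delta>))"
proof -
  have "(\<integral>\<^sup>+t. ennreal (exp (- depth_sum (f n) t)) \<partial>rs_tree p n) \<le> ennreal (exp (- (real n\<^sub>0 * \<delta>)))"
    using n(2)
  proof (induction n rule: dec_induct)
    case base
    have "(\<integral>\<^sup>+t. ennreal (exp (- depth_sum (f n\<^sub>0) t)) \<partial>rs_tree p n\<^sub>0) =
        (\<integral>\<^sup>+t. ennreal (exp (- (real n\<^sub>0 * \<delta>))) \<partial>rs_tree p n\<^sub>0)"
      using set_pmf_rs_graph[of _ p "n\<^sub>0 - 1"] n(1)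
      by (intro nn_integral_cong_AE) (auto simp: AE_measure_pmf_iff rs_tree_def depth_sum_def start)
    then show ?case by simp
  next
    case (step k)
    \<comment> \<open>\<open>rs_tree p k\<close> makes \<open>k - 1\<close> steps, so positivity of
      \<open>k\<close> is what exposes the last one.\<close>
    then obtain m where m: "k = Suc m" using n(1) by (cases k) auto
    have "(\<integral>\<^sup>+t. ennreal (exp (- depth_sum (f (Suc k)) t)) \<partial>rs_tree p (Suc k)) \<le>
        (\<integral>\<^sup>+t. ennreal (exp (- depth_sum (f k) t)) \<partial>rs_tree p k)"
      unfolding m rs_tree_def diff_Suc_1 rs_graph.simps nn_integral_bind_pmf
    proof (intro nn_integral_mono_AE, unfold AE_measure_pmf_iff, intro ballI)
      fix t assume "t \<in> set_pmf (rs_graph p m)"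
      then have "rec_tree t" "length t = k" using set_pmf_rs_graph m by auto
      then show "(\<integral>\<^sup>+t'. ennreal (exp (- depth_sum (f (Suc (Suc m))) t')) \<partial>rs_step p t) \<le>
          ennreal (exp (- depth_sum (f (Suc m)) t))"
        using step.hyps assms(6) by (intro nn_integral_rs_step_exp_neg[OF _ f \<delta>]) (auto simp: m simp del: of_nat_Suc)
    qed
    with step.IH show ?case by (rule order_trans[rotated])
  qed
  moreover have "emeasure (rs_tree p n) {t. real (height t) < h} \<le>
      (\<integral>\<^sup>+t. ennreal (exp (- depth_sum (f n) t)) \<partial>rs_tree p n)"
  proof (subst nn_integral_indicator[symmetric])
    show "(\<integral>\<^sup>+t. indicator {t. real (height t) < h} t \<partial>rs_tree p n) \<le>
        (\<integral>\<^sup>+t. ennreal (exp (- depth_sum (f n) t)) \<partial>rs_tree p n)"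
    proof (intro nn_integral_mono_AE, unfold AE_measure_pmf_iff, intro ballI)
      fix t assume "t \<in> set_pmf (rs_tree p n)"
      then have t: "rec_tree t" using set_pmf_rs_graph by (auto simp: rs_tree_def)
      have "depth_sum (f n) t = 0" if "real (height t) < h"
        unfolding depth_sum_def
      proof (intro sum.neutral ballI final)
        fix v assume "v \<in> {..<length t}"
        then have "depth t v \<le> height t" using height_le_iff[OF t, of "height t"] by auto
        with that show "real (depth t v) < h" by linarith
      qed
      then show "indicator {t. real (height t) < h} t \<le> ennreal (exp (- depth_sum (f n) t))"
        by (auto simp: indicator_def)
    qed
  qed simp
  ultimately have "emeasure (rs_tree p n) {t. real (height t) < h} \<le> ennreal (exp (- (real n\<^sub>0 * \<delta>)))"
    by (rule order_trans[rotated])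
  then show ?thesis by (simp add: measure_pmf.emeasure_eq_measure)
qed

lemma prob_height_lower:
  fixes p c :: real
  assumes p: "0 < p" "p < 1" and c: "0 < c" "c < c_L p"
  shows "(\<lambda>n. measure_pmf.prob (rs_tree p n) {t. real (height t) < c * ln (real n)}) \<longlonglongrightarrow> 0"
proof -
  \<comment> \<open>The profile is built for speed \<open>c\<^sub>2\<close>; the wave moves at
    \<open>c\<^sub>1\<close>, with \<open>1 - \<delta> = c\<^sub>1 / c\<^sub>2\<close> paying for
    the linearisation; the gap down to \<open>c\<close> absorbs the shifts by
    \<open>ln n\<^sub>0\<close> and \<open>x\<^sub>1\<close>.\<close>
  define c\<^sub>1 where "c\<^sub>1 = (c + c_L p) / 2"
  define c\<^sub>2 where "c\<^sub>2 = (c\<^sub>1 + c_L p) / 2"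
  have cs: "c < c\<^sub>1" "c\<^sub>1 < c\<^sub>2" "c\<^sub>2 < c_L p" using c by (auto simp: c\<^sub>1_def c\<^sub>2_def)
  have c\<^sub>2: "0 < c\<^sub>2" using c cs by simp
  have \<alpha>: "0 < 1 / s_param p" using s_param_pos[OF p] by simp
  obtain M e\<^sub>0 :: real and g\<^sub>0 and x\<^sub>1 :: real where M: "0 < M" and e\<^sub>0: "0 < e\<^sub>0" and g\<^sub>0: "mono g\<^sub>0"
    "\<And>x. x \<le> 0 \<Longrightarrow> g\<^sub>0 x = 0" "\<And>x. x\<^sub>1 \<le> x \<Longrightarrow> g\<^sub>0 x = M"
    "\<And>x. 0 \<le> g\<^sub>0 x" "\<And>x. g\<^sub>0 x \<le> M"
    and g\<^sub>0_step: "\<And>x e. 0 \<le> e \<Longrightarrow> e \<le> e\<^sub>0 \<Longrightarrow>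
      c\<^sub>2 * (g\<^sub>0 (x + e) - g\<^sub>0 x) \<le> e * measure_pmf.expectation (geometric_pmf p) (\<lambda>X. g\<^sub>0 (x + 1 - real X))"
    using travelling_profile[OF p \<alpha> c\<^sub>2 cs(3) c_L_sums_0[OF p] c_L_sums_1[OF p] tilt_summable_2[OF p \<alpha>]] by blast
  define \<delta> where "\<delta> = 1 - c\<^sub>1 / c\<^sub>2"
  have \<delta>: "0 < \<delta>" "\<delta> \<le> 1" using c cs by (auto simp: \<delta>_def)
  \<comment> \<open>The profile inequality is linear, so the plateau can be rescaled from
    \<open>M\<close> to \<delta>.\<close>
  define g where "g x = \<delta> / M * g\<^sub>0 x" for x
  have g: "g x \<le> g y" if "x \<le> y" for x y
    unfolding g_def using \<delta> M g\<^sub>0(1) that by (intro mult_left_mono) (auto simp: mono_def)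
  have g0: "g x = 0" if "x \<le> 0" for x using g\<^sub>0(2) that by (simp add: g_def)
  have g\<delta>: "g x = \<delta>" if "x\<^sub>1 \<le> x" for x using g\<^sub>0(3) that M by (simp add: g_def)
  have g_nonneg: "0 \<le> g x" for x using g\<^sub>0(4) \<delta> M by (simp add: g_def)
  have g_le: "g x \<le> \<delta>" for x
    using mult_left_mono[OF g\<^sub>0(5)[of x], of "\<delta> / M"] \<delta> M by (simp add: g_def)
  let ?E = "\<lambda>x. measure_pmf.expectation (geometric_pmf p) (\<lambda>X. g (x + 1 - real X))"
  have g_int: "integrable (geometric_pmf p) (\<lambda>X. g (h X))" for h :: "nat \<Rightarrow> real"
    by (rule integrable_geometric_bounded[where B = \<delta>]) (use g_nonneg g_le in auto)
  have g_step: "g (x + e) - g x \<le> (1 - \<delta>) / k * ?E x"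
    if "0 \<le> e" "e \<le> e\<^sub>0" "e \<le> c\<^sub>1 / k" "0 < k" for x e k
  proof -
    have E0: "0 \<le> ?E x" by (intro Bochner_Integration.integral_nonneg g_nonneg)
    have "\<delta> / M * (c\<^sub>2 * (g\<^sub>0 (x + e) - g\<^sub>0 x)) \<le>
        \<delta> / M * (e * measure_pmf.expectation (geometric_pmf p) (\<lambda>X. g\<^sub>0 (x + 1 - real X)))"
      using \<delta> M that by (intro mult_left_mono g\<^sub>0_step) auto
    then have "c\<^sub>2 * (g (x + e) - g x) \<le> e * ?E x"
      by (simp add: g_def algebra_simps)
    also have "\<dots> \<le> c\<^sub>1 / k * ?E x" using that E0 by (intro mult_right_mono) auto
    also have "\<dots> = c\<^sub>2 * ((1 - \<delta>) / k * ?E x)" using c cs by (simp add: \<delta>_def)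
    finally show ?thesis using c\<^sub>2 by (simp only: mult_le_cancel_left_pos)
  qed
  have bound: "measure_pmf.prob (rs_tree p n) {t. real (height t) < c\<^sub>1 * ln (n / n\<^sub>0) - x\<^sub>1} \<le> exp (- (real n\<^sub>0 * \<delta>))"
    if n: "0 < n\<^sub>0" "c\<^sub>1 / n\<^sub>0 \<le> e\<^sub>0" "n\<^sub>0 \<le> n" for n n\<^sub>0 :: nat
  proof -
    \<comment> \<open>At \<open>k = n\<^sub>0\<close> the argument is at least
      \<open>x\<^sub>1\<close>, on the plateau; at \<open>k = n\<close> it is negative exactly for
      depths below the claimed height.\<close>
    define f where "f k d = g (real d - c\<^sub>1 * ln (real k / n\<^sub>0) + x\<^sub>1)" for k d :: nat
    show ?thesis
    proof (rule prob_height_less_le[where f = f, OF n(1,3) _ _ \<delta>(2)])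
      fix k d :: nat assume k: "n\<^sub>0 \<le> k"
      define x where "x = real d - c\<^sub>1 * ln (real (Suc k) / n\<^sub>0) + x\<^sub>1"
      define e where "e = c\<^sub>1 * (ln (real (Suc k)) - ln (real k))"
      have "ln (real (Suc k)) - ln (real k) \<le> 1 / k"
        using ln_diff_le[of "real (Suc k)" "real k"] k n(1) by simp
      then have "e \<le> c\<^sub>1 * (1 / k)" unfolding e_def using c cs by (intro mult_left_mono) auto
      then have e: "e \<le> c\<^sub>1 / k" by simp
      also have "\<dots> \<le> c\<^sub>1 / n\<^sub>0" using k n(1) c cs by (intro divide_left_mono) auto
      finally have e': "e \<le> e\<^sub>0" using n(2) by simp
      have "0 \<le> e" unfolding e_def using c cs k n(1) by simp
      then have "g (x + e) - g x \<le> (1 - \<delta>) / k * ?E x"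
        using e e' k n(1) by (intro g_step) auto
      moreover have "g (x + e) = f k d" "g x = f (Suc k) d"
        using k n(1) by (simp_all add: f_def x_def e_def ln_div algebra_simps del: of_nat_Suc)
      \<comment> \<open>Stopping at the root only raises the new depth,
        \<open>Suc (d - X) \<ge> d + 1 - X\<close>, and \<open>g\<close> is monotone.\<close>
      moreover have "?E x \<le> measure_pmf.expectation (geometric_pmf p) (\<lambda>X. f (Suc k) (Suc (d - X)))"
        unfolding f_def by (intro integral_mono g_int g) (auto simp: x_def)
      then have "(1 - \<delta>) / k * ?E x \<le> (1 - \<delta>) / k *
          measure_pmf.expectation (geometric_pmf p) (\<lambda>X. f (Suc k) (Suc (d - X)))"
        using \<delta> by (intro mult_left_mono) auto
      ultimately show "f k d \<le> f (Suc k) d + (1 - \<delta>) / k *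
          measure_pmf.expectation (geometric_pmf p) (\<lambda>X. f (Suc k) (Suc (d - X)))"
        by linarith
    qed (use n(1) in \<open>auto simp: f_def g_nonneg g_le intro!: g0 g\<delta>\<close>)
  qed
  show ?thesis
  proof (rule LIMSEQ_I)
    fix r :: real assume r: "0 < r"
    have "(\<lambda>m. exp (- (real m * \<delta>))) \<longlonglongrightarrow> 0" "(\<lambda>m. c\<^sub>1 / real m) \<longlonglongrightarrow> 0"
      using \<delta> by real_asymp+
    then have "\<forall>\<^sub>F m in sequentially. exp (- (real m * \<delta>)) < r" "\<forall>\<^sub>F m in sequentially. c\<^sub>1 / real m < e\<^sub>0"
      using r e\<^sub>0 by (auto dest: order_tendstoD)
    with eventually_gt_at_top[of 0]
    have "\<forall>\<^sub>F m in sequentially. 0 < m \<and> exp (- (real m * \<delta>)) < r \<and> c\<^sub>1 / real m \<le> e\<^sub>0"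
      by eventually_elim auto
    \<comment> \<open>The starting time is fixed by \<open>r\<close> before \<open>n\<close> grows,
      so its effect on the height is only a constant.\<close>
    then obtain m :: nat where m: "0 < m" "exp (- (real m * \<delta>)) < r" "c\<^sub>1 / real m \<le> e\<^sub>0"
      by (auto simp: eventually_sequentially)
    have "\<forall>\<^sub>F n in sequentially. c * ln (real n) \<le> c\<^sub>1 * ln (real n / m) - x\<^sub>1"
      using cs c m(1) by real_asymp
    with eventually_ge_at_top[of m]
    have "\<forall>\<^sub>F n in sequentially. norm (measure_pmf.prob (rs_tree p n)
        {t. real (height t) < c * ln (real n)} - 0) < r"
    proof eventually_elim
      case (elim n)
      have "measure_pmf.prob (rs_tree p n) {t. real (height t) < c * ln (real n)} \<le>
          measure_pmf.prob (rs_tree p n) {t. real (height t) < c\<^sub>1 * ln (n / m) - x\<^sub>1}"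
        using elim by (intro measure_pmf.finite_measure_mono) auto
      also have "\<dots> \<le> exp (- (m * \<delta>))" using bound[of m n] m elim by simp
      finally show ?case using m by simp
    qed
    then show "\<exists>no. \<forall>n\<ge>no. norm (measure_pmf.prob (rs_tree p n)
        {t. real (height t) < c * ln (real n)} - 0) < r"
      by (simp add: eventually_sequentially)
  qed
qed

theorem theorem2:
  fixes p \<epsilon> :: real
  assumes "0 < p" "p < 1" "\<epsilon> > 0"
  shows "(\<lambda>n. measure_pmf.prob (rs_tree p n)
            {t. (c_L p - \<epsilon>) * ln (real n) \<le> real (height t)
              \<and> real (height t) \<le> (c_U p + \<epsilon>) * ln (real n)})
         \<longlonglongrightarrow> 1"
proof -
  \<comment> \<open>\<open>prob_height_lower\<close> needs a positive speed, while
    \<open>c_L p - \<epsilon>\<close> may be nonpositive.\<close>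
  define c where "c = max (c_L p - \<epsilon>) (c_L p / 2)"
  have c: "0 < c" "c < c_L p" using c_L_pos[OF assms(1,2)] assms(3) by (auto simp: c_def)
  define L where "L n = {t. real (height t) < c * ln (real n)}" for n
  define U where "U n = {t. (c_U p + \<epsilon>) * ln (real n) < real (height t)}" for n
  define G where "G n = {t. (c_L p - \<epsilon>) * ln (real n) \<le> real (height t)
      \<and> real (height t) \<le> (c_U p + \<epsilon>) * ln (real n)}" for n
  let ?P = "\<lambda>n. measure_pmf.prob (rs_tree p n)"
  obtain \<alpha> \<phi> where "0 < \<alpha>" "(\<lambda>k. (1 - p) ^ k * p * exp (\<alpha> * (1 - real k))) sums \<phi>"
    "\<phi> \<le> c_U p * \<alpha>" "1 \<le> c_U p * \<alpha>"
    using c_U_exponent[OF assms(1,2)] .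
  then have "(\<lambda>n. ?P n (U n)) \<longlonglongrightarrow> 0" unfolding U_def
    using assms by (intro prob_height_upper) auto
  moreover have "(\<lambda>n. ?P n (L n)) \<longlonglongrightarrow> 0" unfolding L_def
    using assms c by (intro prob_height_lower) auto
  ultimately have lim: "(\<lambda>n. 1 - (?P n (L n) + ?P n (U n))) \<longlonglongrightarrow> 1"
    by (auto intro!: tendsto_eq_intros)
  have "\<forall>\<^sub>F n in sequentially. 1 - (?P n (L n) + ?P n (U n)) \<le> ?P n (G n)"
    using eventually_ge_at_top[of 1]
  proof eventually_elim
    case (elim n)
    have "(c_L p - \<epsilon>) * ln (real n) \<le> c * ln (real n)"
      using elim by (intro mult_right_mono) (auto simp: c_def)
    then have "UNIV \<subseteq> (L n \<union> U n) \<union> G n" by (auto simp: L_def U_def G_def)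
    then have "1 \<le> ?P n ((L n \<union> U n) \<union> G n)"
      by (metis measure_pmf.prob_space_axioms measure_pmf_UNIV order_refl top.extremum_uniqueI)
    also have "\<dots> \<le> ?P n (L n \<union> U n) + ?P n (G n)"
      by (intro measure_Un_le) auto
    also have "?P n (L n \<union> U n) \<le> ?P n (L n) + ?P n (U n)"
      by (intro measure_Un_le) auto
    finally show ?case by simp
  qed
  then have "(\<lambda>n. ?P n (G n)) \<longlonglongrightarrow> 1"
    by (rule tendsto_sandwich[OF _ _ lim tendsto_const]) (auto intro: always_eventually)
  then show ?thesis by (simp add: G_def)
qed

end
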